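(* Let $q_c\approx 2.32472$ be the real root of $x^3-3x^2+2x-1=0$ and let $q^*=(3+\sqrt5)/2$. (i) Let $q\in\mathcal{B}_{\aleph_0}\setminus(q_c,q^* )$. Then $\mathcal{U}_q^{(\aleph_0)}$ is countably infinite. (ii) For any $q>1$ we have $\dim_H\mathcal{U}_q^{(2^{\aleph_0})}=\dim_H E_q$.
   Context: For a real number $q>1$, a $q$-expansion of a real number $x$ is an infinite sequence $(d_i)_{i\ge1}$ with $d_i\in\{0,1,q\}$ for all $i\ge 1$ and $x=\sum_{i=1}^\infty d_i/q^i$ (the digit set depends on $q$). Let $E_q$ be the set of real numbers having at least one $q$-expansion. $\mathcal{B}_{\aleph_0}$ is the set of all $q\in(1,\infty)$ for which there exists $x\in E_q$ whose set of $q$-expansions has cardinality exactly $\aleph_0$. For $k\in\{\aleph_0,2^{\aleph_0}\}$, $\mathcal{U}_q^{(k)}$ is the set of all $x\in E_q$ whose set of $q$-expansions has cardinality exactly $k$. $\dim_H$ denotes Hausdorff dimension. *)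

theory Defs
  imports "HOL-Analysis.Analysis" "HOL-Library.Equipollence"
begin

text \<open>Sequences are indexed from \<open>0\<close>, so \<open>d i\<close> is the digit attached to
  \<open>1 / q ^ (i + 1)\<close>.\<close>

definition q_expansions :: "real \<Rightarrow> real \<Rightarrow> (nat \<Rightarrow> real) set" where
  "q_expansions q x =
     {d. (\<forall>i. d i \<in> {0, 1, q}) \<and> (\<lambda>i. d i / q ^ Suc i) sums x}"

definition E_set :: "real \<Rightarrow> real set" where
  "E_set q = {x. q_expansions q x \<noteq> {}}"

text \<open>The cardinal is represented by a set having that cardinality:
  \<open>UNIV :: nat set\<close> for \<open>\<aleph>\<close>-zero and \<open>UNIV :: nat set set\<close> for the continuum.\<close>

definition U_set :: "real \<Rightarrow> 'k set \<Rightarrow> real set" where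
  "U_set q K = {x \<in> E_set q. q_expansions q x \<approx> K}"

definition B_aleph0 :: "real set" where
  "B_aleph0 = {q. 1 < q \<and> (\<exists>x \<in> E_set q. q_expansions q x \<approx> (UNIV :: nat set))}"

definition q_c :: real where
  "q_c = (THE x. x ^ 3 - 3 * x ^ 2 + 2 * x - 1 = 0)"

definition q_star :: real where
  "q_star = (3 + sqrt 5) / 2"

text \<open>For \<open>s = 0\<close> every nonempty set has weight \<open>1\<close>; this case is separate because
  \<open>0 powr 0 = 0\<close>. Covering sets are required to be bounded because \<^const>\<open>diameter\<close>
  is unspecified on unbounded sets.\<close>

definition hausdorff_weight :: "real \<Rightarrow> 'a::metric_space set \<Rightarrow> ennreal" where
  "hausdorff_weight s V =
     (if V = {} then 0 else if s = 0 then 1 else ennreal (diameter V powr s))"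

definition hausdorff_premeasure :: "real \<Rightarrow> real \<Rightarrow> 'a::metric_space set \<Rightarrow> ennreal" where
  "hausdorff_premeasure s \<delta> A =
     (INF V \<in> {V :: nat \<Rightarrow> 'a set.
                 A \<subseteq> (\<Union>i. V i) \<and> (\<forall>i. bounded (V i) \<and> diameter (V i) \<le> \<delta>)}.
        \<Sum>i. hausdorff_weight s (V i))"

definition hausdorff_measure :: "real \<Rightarrow> 'a::metric_space set \<Rightarrow> ennreal" where
  "hausdorff_measure s A = (SUP \<delta> \<in> {0<..}. hausdorff_premeasure s \<delta> A)"

definition hausdorff_dim :: "'a::metric_space set \<Rightarrow> ennreal" where
  "hausdorff_dim A = (INF s \<in> {s. 0 \<le> s \<and> hausdorff_measure s A = 0}. ennreal s)"

lemma q_c_ex1: "\<exists>!x::real. x ^ 3 - 3 * x ^ 2 + 2 * x - 1 = 0"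
proof -
  define f where "f = (\<lambda>x::real. x ^ 3 - 3 * x ^ 2 + 2 * x - 1)"
  have "\<exists>x\<ge>2. x \<le> 3 \<and> f x = 0"
    by (rule IVT') (auto simp: f_def intro!: continuous_intros)
  then obtain x where x: "f x = 0" "2 \<le> x" by blast
  have "y = x" if y: "f y = 0" for y
  proof (rule ccontr)
    assume ne: "y \<noteq> x"
    define u where "u = x - 1"
    define v where "v = y - 1"
    have "f x - f y = (u - v) * (u^2 + u * v + v^2 - 1)"
      by (simp add: f_def u_def v_def algebra_simps power2_eq_square power3_eq_cube)
    then have a: "u^2 + u * v + v^2 = 1"
      using x y ne by (simp add: u_def v_def)
    have b: "u^3 = u + 1"
      using x by (simp add: f_def u_def algebra_simps power2_eq_square power3_eq_cube)
    have u1: "u \<ge> 1" using x by (simp add: u_def)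
    have "4 * (u^2 + u * v + v^2) = (u + 2 * v)^2 + 3 * u^2"
      by (simp add: algebra_simps power2_eq_square)
    then have "3 * u^2 \<le> 4"
      using a by (smt (verit) zero_le_power2)
    then have "3 * u^2 * u \<le> 4 * u"
      using u1 by (intro mult_right_mono) auto
    then have "3 * (u + 1) \<le> 4 * u"
      using b by (simp add: power2_eq_square power3_eq_cube)
    then have "u \<ge> 3" by simp
    then have "u * u \<ge> 3 * 3" by (intro mult_mono) auto
    with \<open>3 * u^2 \<le> 4\<close> show False by (simp add: power2_eq_square)
  qed
  then show ?thesis using x unfolding f_def by blast
qed

lemma q_c_root: "q_c ^ 3 - 3 * q_c ^ 2 + 2 * q_c - 1 = 0"
  unfolding q_c_def by (rule theI') (rule q_c_ex1)

lemma q_c_bounds: "2.3247 < q_c" "q_c < 2.3248"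
proof -
  define f where "f = (\<lambda>x::real. x ^ 3 - 3 * x ^ 2 + 2 * x - 1)"
  have "\<exists>x\<ge>2.3247. x \<le> 2.3248 \<and> f x = 0"
    by (rule IVT') (auto simp: f_def power2_eq_square power3_eq_cube intro!: continuous_intros)
  then obtain x where x: "f x = 0" "2.3247 \<le> x" "x \<le> 2.3248" by blast
  have "q_c = x" using q_c_ex1 q_c_root x(1) unfolding f_def by blast
  moreover have "x \<noteq> 2.3247" "x \<noteq> 2.3248"
    using x(1) by (force simp: f_def power2_eq_square power3_eq_cube)+
  ultimately show "2.3247 < q_c" "q_c < 2.3248" using x by auto
qed

end

theory Submission
  imports Defs
begin

text \<open>The words \<open>0q\<close> and \<open>10\<close> have the same value, so a point with an expansion containing
  infinitely many of them has continuum many expansions. More generally, a set of points each of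
  which branches back into the set consists of points with continuum many expansions; hence a point
  without continuum many expansions has an expansion with a tail that is the unique expansion of its value.

  For \<open>q \<le> q_c\<close> only the two end points \<open>0\<close> and \<open>q / (q - 1)\<close> of \<open>E_set q\<close> have a unique
  expansion, so the points without continuum many expansions form a countable set. For
  \<open>q \<ge> q_star\<close> the only coincidences besides \<open>0q = 10\<close> are at single points, and an infinite set
  of expansions without infinitely many exchangeable words forces a tail of ones. In either case a
  point with \<open>\<aleph>\<close>-zero expansions yields infinitely many others by prepending zeros or \<open>q\<close>s.

  For the dimension, a point without continuum many expansions has an expansion with a tail
  avoiding \<open>0q\<close> and \<open>10\<close>. The number of such words of length \<open>n\<close> grows like \<open>q_c ^ n\<close>, so these
  points have dimension at most \<open>log q q_c\<close> when \<open>q > q_c\<close>. This is smaller than the dimension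
  of \<open>E_set q\<close>: an interval for \<open>q \<le> q_star\<close>; and for \<open>q > q_star\<close> replacing the base \<open>q\<close> by
  \<open>q_star\<close> on sequences avoiding \<open>10\<close> is Hoelder continuous with exponent \<open>log q q_star\<close> and
  maps \<open>E_set q\<close> onto an interval.\<close>

section \<open>Digit expansions\<close>

lemma q_star_root: "q_star\<^sup>2 - 3 * q_star + 1 = 0"
proof -
  have "(sqrt 5)\<^sup>2 = 5" by simp
  then show ?thesis unfolding q_star_def by (simp add: field_simps power2_eq_square)
qed

lemma q_star_gt_2: "2 < q_star" and q_c_less_q_star: "q_c < q_star"
proof -
  have "2 \<le> sqrt 5" by (rule real_le_rsqrt) simp
  then show "2 < q_star" "q_c < q_star" using q_c_bounds unfolding q_star_def by simp_all
qed

text \<open>The value of the word \<open>w\<close> followed by a tail of value \<open>y\<close>: a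
  composition of the contractions \<open>\<lambda>z. (d + z) / q\<close>, whose attractor is
  \<open>E_set q\<close>.\<close>

definition prefix_map :: "real \<Rightarrow> real list \<Rightarrow> real \<Rightarrow> real" where
  "prefix_map q w y = foldr (\<lambda>d z. (d + z) / q) w y"

lemma prefix_map_Nil [simp]: "prefix_map q [] y = y"
  and prefix_map_Cons [simp]: "prefix_map q (d # w) y = (d + prefix_map q w y) / q"
  and prefix_map_append: "prefix_map q (u @ v) y = prefix_map q u (prefix_map q v y)"
  by (simp_all add: prefix_map_def)

lemma countable_prefix_images:
  assumes "countable A"
  shows "countable {prefix_map q w y | w y. w \<in> lists {0, 1, q} \<and> y \<in> A}"
proof -
  have "{prefix_map q w y | w y. w \<in> lists {0, 1, q} \<and> y \<in> A}
      = (\<lambda>(w, y). prefix_map q w y) ` (lists {0, 1, q} \<times> A)"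
    by auto
  then show ?thesis using assms by (simp add: countable_SIGMA)
qed

context
  fixes q :: real
  assumes q1: "1 < q"
begin

text \<open>Deleting the first digit multiplies the value by \<open>q\<close> and subtracts that
  digit. Expansions thereby become orbits of the maps \<open>\<lambda>y. q * y - a\<close>, and most
  later arguments are about these orbits.\<close>

lemma expansion_iff:
  "d \<in> q_expansions q x \<longleftrightarrow>
     d 0 \<in> {0, 1, q} \<and> (\<lambda>i. d (Suc i)) \<in> q_expansions q (q * x - d 0)"
proof -
  have "(\<lambda>i. d i / q ^ Suc i) sums x \<longleftrightarrow> (\<lambda>i. d (Suc i) / q ^ Suc (Suc i)) sums (x - d 0 / q)"
    using sums_Suc_iff [of "\<lambda>i. d i / q ^ Suc i" "x - d 0 / q"] by simp
  also have "\<dots> \<longleftrightarrow> (\<lambda>i. q * (d (Suc i) / q ^ Suc (Suc i))) sums (q * (x - d 0 / q))"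
    by (rule sums_mult_iff [symmetric]) (use q1 in simp)
  also have "(\<lambda>i. q * (d (Suc i) / q ^ Suc (Suc i))) = (\<lambda>i. d (Suc i) / q ^ Suc i)"
    using q1 by auto
  also have "q * (x - d 0 / q) = q * x - d 0"
    using q1 by (simp add: field_simps)
  finally have "(\<lambda>i. d i / q ^ Suc i) sums x \<longleftrightarrow> (\<lambda>i. d (Suc i) / q ^ Suc i) sums (q * x - d 0)" .
  moreover have "(\<forall>i. d i \<in> {0, 1, q}) \<longleftrightarrow> d 0 \<in> {0, 1, q} \<and> (\<forall>i. d (Suc i) \<in> {0, 1, q})"
    by (metis not0_implies_Suc)
  ultimately show ?thesis unfolding q_expansions_def by blast
qed

lemma expansion_case_nat:
  assumes "a \<in> {0, 1, q}" "d \<in> q_expansions q (q * x - a)"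
  shows "case_nat a d \<in> q_expansions q x"
  using assms by (subst expansion_iff) simp

lemma expansion_bounds:
  assumes "d \<in> q_expansions q x"
  shows "0 \<le> x" "x \<le> q / (q - 1)"
proof -
  have d: "\<And>i. d i \<in> {0, 1, q}" "(\<lambda>i. d i / q ^ Suc i) sums x"
    using assms by (auto simp: q_expansions_def)
  have d_bds: "0 \<le> d i \<and> d i \<le> q" for i using d(1) [of i] q1 by auto
  have "(\<lambda>i::nat. 0::real) sums 0" by simp
  then show "0 \<le> x"
    by (rule sums_le [OF _ _ d(2), rotated]) (use d_bds q1 in auto)
  have "(\<lambda>i. (1 / q) ^ i) sums (1 / (1 - 1 / q))"
    by (rule geometric_sums) (use q1 in simp)
  then have g: "(\<lambda>i. (1 / q) ^ i) sums (q / (q - 1))"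
    using q1 by (simp add: field_simps)
  show "x \<le> q / (q - 1)"
  proof (rule sums_le [OF _ d(2) g])
    fix i
    have "d i / q ^ Suc i \<le> q / q ^ Suc i"
      using d_bds q1 by (intro divide_right_mono) auto
    then show "d i / q ^ Suc i \<le> (1 / q) ^ i"
      using q1 by (simp add: power_one_over field_simps)
  qed
qed

lemma E_bounds:
  assumes "x \<in> E_set q"
  shows "0 \<le> x" "x \<le> q / (q - 1)"
  using assms expansion_bounds by (auto simp: E_set_def)

lemma E_unstep:
  assumes "d \<in> q_expansions q x"
  shows "q * x - d 0 \<in> E_set q" "d 0 \<in> {0, 1, q}"
  using iffD1 [OF expansion_iff assms] by (auto simp: E_set_def)

lemma expansion_shift:
  assumes "d \<in> q_expansions q x"
  shows "\<exists>y \<in> E_set q. x = prefix_map q (map d [0..<n]) y \<and> (\<lambda>i. d (i + n)) \<in> q_expansions q y"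
proof (induction n)
  case 0
  then show ?case using assms by (auto simp: E_set_def)
next
  case (Suc n)
  then obtain y where y: "x = prefix_map q (map d [0..<n]) y" "(\<lambda>i. d (i + n)) \<in> q_expansions q y"
    by blast
  have "(\<lambda>i. d (Suc i + n)) \<in> q_expansions q (q * y - d n)"
    using y(2) by (subst (asm) expansion_iff) simp
  moreover have "y = (d n + (q * y - d n)) / q" using q1 by simp
  then have "x = prefix_map q (map d [0..<Suc n]) (q * y - d n)"
    using y(1) by (simp add: prefix_map_append)
  ultimately show ?case by (auto simp: E_set_def)
qed

lemma prefix_map_eq_sum:
  "prefix_map q w y = (\<Sum>i<length w. w ! i / q ^ Suc i) + y / q ^ length w"
proof (induction w)
  case (Cons a w)
  have "(\<Sum>i<length (a # w). (a # w) ! i / q ^ Suc i)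
      = a / q + (\<Sum>i<length w. w ! i / q ^ Suc i) / q"
    by (simp add: sum.lessThan_Suc_shift sum_divide_distrib mult.commute del: sum.lessThan_Suc)
  then show ?case using Cons q1 by (simp add: field_simps)
qed simp

lemma expansions_exist:
  assumes dig: "\<And>i. d i \<in> {0, 1, q}"
  shows "\<exists>x. d \<in> q_expansions q x"
proof -
  have "summable (\<lambda>i. (1 / q) ^ i)"
    by (rule summable_geometric) (use q1 in simp)
  then have "summable (\<lambda>i. d i / q ^ Suc i)"
  proof (rule summable_comparison_test')
    fix i
    have "0 \<le> d i" "d i \<le> q" using dig [of i] q1 by auto
    then have "d i / q ^ Suc i \<le> q / q ^ Suc i"
      using q1 by (intro divide_right_mono) auto
    then show "norm (d i / q ^ Suc i) \<le> (1 / q) ^ i"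
      using q1 \<open>0 \<le> d i\<close> by (simp add: power_one_over field_simps)
  qed
  then show ?thesis using dig by (auto simp: summable_def q_expansions_def)
qed

text \<open>The remainder is at most \<open>q / (q - 1) / q ^ N n\<close> with
  \<open>n \<le> N n\<close>, so the partial sums along \<open>N\<close> tend to \<open>x\<close>;
  the whole series converges in any case and has the same limit. The lengths \<open>N n\<close> are
  left free because the branching argument appends words of varying length.\<close>

lemma expansion_if_prefixes:
  assumes dig: "\<And>i. d i \<in> {0, 1, q}"
    and N: "\<And>n. n \<le> N n"
    and pre: "\<And>n. x = prefix_map q (map d [0..<N n]) (y n)"
    and y: "\<And>n. y n \<in> {0..q / (q - 1)}"
  shows "d \<in> q_expansions q x"
proof -
  let ?f = "\<lambda>i. d i / q ^ Suc i"
  obtain s where s: "?f sums s"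
    using expansions_exist [of d] dig by (auto simp: q_expansions_def)
  have Ninf: "filterlim N at_top sequentially"
    by (rule filterlim_at_top_mono [OF filterlim_ident]) (simp add: N)
  have "(\<lambda>n. sum ?f {..<N n}) \<longlonglongrightarrow> s"
    using filterlim_compose [OF s [unfolded sums_def] Ninf] .
  moreover have "(\<lambda>n. sum ?f {..<N n}) \<longlonglongrightarrow> x"
  proof (rule LIMSEQ_I)
    fix r :: real assume "0 < r"
    have "(\<lambda>n. q / (q - 1) * (1 / q) ^ n) \<longlonglongrightarrow> q / (q - 1) * 0"
      by (intro tendsto_mult tendsto_const LIMSEQ_power_zero) (use q1 in simp)
    then have "\<forall>\<^sub>F n in sequentially. q / (q - 1) * (1 / q) ^ n < r"
      using \<open>0 < r\<close> by (auto dest: order_tendstoD(2))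
    then obtain n0 where n0: "\<And>n. n \<ge> n0 \<Longrightarrow> q / (q - 1) * (1 / q) ^ n < r"
      by (auto simp: eventually_sequentially)
    have "norm (sum ?f {..<N n} - x) < r" if "n \<ge> n0" for n
    proof -
      have "x = sum ?f {..<N n} + y n / q ^ N n"
        using pre [of n] by (simp add: prefix_map_eq_sum)
      then have "norm (sum ?f {..<N n} - x) = y n / q ^ N n"
        using y [of n] q1 by simp
      also have "\<dots> \<le> (q / (q - 1)) / q ^ N n"
        using y [of n] q1 by (intro divide_right_mono) auto
      also have "\<dots> = q / (q - 1) * (1 / q) ^ N n"
        by (simp add: power_one_over)
      also have "\<dots> < r"
        using n0 [of "N n"] N [of n] that by simp
      finally show ?thesis .
    qed
    then show "\<exists>no. \<forall>n\<ge>no. norm (sum ?f {..<N n} - x) < r" by blast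
  qed
  ultimately have "s = x" by (rule LIMSEQ_unique)
  then show ?thesis using s dig by (simp add: q_expansions_def)
qed

text \<open>Iterating the choice of a digit that stays in \<open>S\<close> produces digits with
  bounded remainders, which is enough for an expansion. The predicate \<open>P\<close> records the
  rule of choice, so that properties of the digits can be read off later.\<close>

lemma E_if_closed:
  assumes "\<And>y. y \<in> S \<Longrightarrow> \<exists>a\<in>{0, 1, q}. P y a \<and> q * y - a \<in> S"
    and "S \<subseteq> {0..q / (q - 1)}" "x \<in> S"
  shows "\<exists>d \<in> q_expansions q x. \<exists>r. r 0 = x \<and> (\<forall>n. r n \<in> S \<and> P (r n) (d n) \<and> r (Suc n) = q * r n - d n)"
proof -
  obtain a where a: "\<And>y. y \<in> S \<Longrightarrow> a y \<in> {0, 1, q} \<and> P y (a y) \<and> q * y - a y \<in> S"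
    using assms(1) by metis
  define r where "r = rec_nat x (\<lambda>_ y. q * y - a y)"
  have r0: "r 0 = x" and rS: "r (Suc n) = q * r n - a (r n)" for n
    by (simp_all add: r_def)
  have rS': "r n \<in> S" for n
    by (induction n) (use r0 rS assms a in auto)
  have pre: "x = prefix_map q (map (\<lambda>n. a (r n)) [0..<n]) (r n)" for n
  proof (induction n)
    case (Suc n)
    have "r n = (a (r n) + r (Suc n)) / q" using q1 rS by simp
    then show ?case using Suc by (simp add: prefix_map_append)
  qed (simp add: r0)
  have 1: "(\<lambda>n. a (r n)) \<in> q_expansions q x"
  proof (rule expansion_if_prefixes [where N = "\<lambda>n. n" and y = r])
    show "a (r i) \<in> {0, 1, q}" for i using a [OF rS'] by simp
    show "r i \<in> {0..q / (q - 1)}" for i using rS' assms(2) by blast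
  qed (simp, rule pre)
  have "P (r n) (a (r n))" for n using a [OF rS'] by simp
  then show ?thesis
    by (intro bexI [OF _ 1] exI [of _ r]) (simp add: r0 rS rS')
qed

section \<open>The end points and the shape of the set of expandable numbers\<close>

lemma expansions_zero: "q_expansions q 0 \<subseteq> {\<lambda>_. 0}"
proof
  fix d assume d: "d \<in> q_expansions q 0"
  have "(\<lambda>i. d (i + n)) \<in> q_expansions q 0 \<and> d n = 0" for n
  proof (induction n)
    case 0
    have "q * 0 - d 0 \<in> E_set q" "d 0 \<in> {0, 1, q}" using E_unstep [OF d] by auto
    then show ?case using d E_bounds [of "- d 0"] q1 by auto
  next
    case (Suc n)
    then have "(\<lambda>i. d (i + n)) \<in> q_expansions q 0" "d n = 0" by auto
    then have *: "(\<lambda>i. d (Suc i + n)) \<in> q_expansions q 0"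
      by (subst (asm) expansion_iff) simp
    have "- d (Suc n) \<in> E_set q" "d (Suc n) \<in> {0, 1, q}" using E_unstep [OF *] by auto
    then show ?case using * E_bounds [of "- d (Suc n)"] q1 by auto
  qed
  then show "d \<in> {\<lambda>_. 0}" by auto
qed

lemma expansions_top: "q_expansions q (q / (q - 1)) \<subseteq> {\<lambda>_. q}"
proof
  let ?M = "q / (q - 1)"
  have M: "q * ?M = ?M + q" using q1 by (simp add: field_simps)
  have dq: "d 0 = q" if "d \<in> q_expansions q ?M" for d
    using E_unstep [OF that] E_bounds(2) [of "q * ?M - d 0"] M q1 by auto
  fix d assume d: "d \<in> q_expansions q ?M"
  have "(\<lambda>i. d (i + n)) \<in> q_expansions q ?M" for n
  proof (induction n)
    case (Suc n)
    have "(\<lambda>i. d (Suc i + n)) \<in> q_expansions q (q * ?M - d n)"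
      using Suc by (subst (asm) expansion_iff) simp
    moreover have "d n = q" using dq [OF Suc] by simp
    ultimately show ?case using M by simp
  qed (use d in simp)
  then have "d n = q" for n using dq [of "\<lambda>i. d (i + n)"] by simp
  then show "d \<in> {\<lambda>_. q}" by auto
qed

text \<open>The second root of the quadratic is \<open>3 - q_star\<close>, which lies below
  1.\<close>

lemma q_star_quadratic: "q\<^sup>2 - 3 * q + 1 \<le> 0 \<longleftrightarrow> q \<le> q_star"
proof -
  have "0 < q + q_star - 3" using q1 q_star_gt_2 by simp
  moreover have "q\<^sup>2 - 3 * q + 1 = (q - q_star) * (q + q_star - 3)"
    using q_star_root by (simp add: algebra_simps power2_eq_square)
  ultimately show ?thesis by (simp add: mult_le_0_iff)
qed

text \<open>The contractions for the digits 0, 1, \<open>q\<close> map the interval onto three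
  subintervals starting at 0, \<open>1 / q\<close> and 1, each of length \<open>1 / (q - 1)\<close>.
  The first two always overlap, the last two exactly when \<open>q \<le> q_star\<close>; then every
  point has a digit whose remainder stays in the interval.\<close>

lemma E_eq_interval:
  assumes "q \<le> q_star"
  shows "E_set q = {0..q / (q - 1)}"
proof
  show "E_set q \<subseteq> {0..q / (q - 1)}" using E_bounds by auto
next
  have "q\<^sup>2 - 3 * q + 1 \<le> 0" using assms q_star_quadratic by simp
  then have le1: "1 \<le> 1 / q + 1 / (q - 1)"
    using q1 by (simp add: field_simps power2_eq_square)
  have M: "q / (q - 1) = 1 + 1 / (q - 1)" using q1 by (simp add: field_simps)
  show "{0..q / (q - 1)} \<subseteq> E_set q"
  proof
    fix x assume "x \<in> {0..q / (q - 1)}"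
    moreover have "\<exists>a\<in>{0, 1, q}. True \<and> q * y - a \<in> {0..q / (q - 1)}"
      if y: "y \<in> {0..q / (q - 1)}" for y
    proof -
      consider "y \<le> 1 / (q - 1)" | "1 / q \<le> y" "y \<le> 1 / q + 1 / (q - 1)" | "1 \<le> y"
        using le1 q1 by (smt (verit) frac_le)
      then show ?thesis
      proof cases
        case 1
        then have "q * y \<le> q * (1 / (q - 1))" using q1 by (intro mult_left_mono) auto
        then show ?thesis using y q1 by (intro bexI [of _ 0]) auto
      next
        case 2
        then have "q * y \<le> q * (1 / q + 1 / (q - 1))" using q1 by (intro mult_left_mono) auto
        moreover have "1 \<le> q * y" using 2 q1 by (simp add: field_simps)
        ultimately show ?thesis using y q1 by (intro bexI [of _ 1]) (auto simp: distrib_left)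
      next
        case 3
        have "q * y \<le> q * (q / (q - 1))" using q1 y by (intro mult_left_mono) auto
        also have "\<dots> = q / (q - 1) + q" using q1 by (simp add: field_simps)
        finally show ?thesis using 3 q1 by (intro bexI [of _ q]) auto
      qed
    qed
    ultimately show "x \<in> E_set q"
      using E_if_closed [of "{0..q / (q - 1)}" "\<lambda>_ _. True" x] by (auto simp: E_set_def)
  qed
qed

end

section \<open>Branching and the cardinality of the set of expansions\<close>

definition swap_spot :: "real \<Rightarrow> (nat \<Rightarrow> real) \<Rightarrow> nat \<Rightarrow> bool" where
  "swap_spot q d i \<longleftrightarrow> (d i = 0 \<and> d (Suc i) = q) \<or> (d i = 1 \<and> d (Suc i) = 0)"

lemma swap_spot_shift: "swap_spot q (\<lambda>i. d (i + n)) i \<longleftrightarrow> swap_spot q d (i + n)"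
  by (simp add: swap_spot_def)

context
  fixes q :: real
  assumes q1: "1 < q"
begin

lemma expansions_lepoll_continuum: "q_expansions q x \<lesssim> (UNIV :: nat set set)"
proof -
  \<comment> \<open>Two bits per digit: \<open>2 * i\<close> marks a 1, \<open>2 * i + 1\<close>
    marks a \<open>q\<close>, and a 0 leaves both unmarked.\<close>
  define code where "code d = {2 * i | i. d i = 1} \<union> {2 * i + 1 | i. d i = q}" for d :: "nat \<Rightarrow> real"
  have code: "2 * i \<in> code d \<longleftrightarrow> d i = 1" "2 * i + 1 \<in> code d \<longleftrightarrow> d i = q" for d i
    by (auto simp: code_def) presburger+
  have "inj_on code (q_expansions q x)"
  proof (rule inj_onI, rule ext)
    fix d e i assume de: "d \<in> q_expansions q x" "e \<in> q_expansions q x" "code d = code e"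
    then have "d i \<in> {0, 1, q}" "e i \<in> {0, 1, q}" by (auto simp: q_expansions_def)
    moreover have "d i = 1 \<longleftrightarrow> e i = 1" "d i = q \<longleftrightarrow> e i = q" using code de(3) by metis+
    ultimately show "d i = e i" by auto
  qed
  then show ?thesis unfolding lepoll_def by blast
qed

lemma continuum_not_countable:
  assumes "(UNIV :: nat set set) \<lesssim> q_expansions q x"
  shows "\<not> countable (q_expansions q x)"
proof
  assume "countable (q_expansions q x)"
  then have "countable (UNIV :: nat set set)"
    using assms countable_lepoll by blast
  then show False
    using Cantors_theorem [of "UNIV :: nat set"] uncountable_def
    by (metis Pow_UNIV UNIV_not_empty)
qed

text \<open>A set \<open>B\<close> of natural numbers steers a walk inside \<open>S\<close>: stage
  \<open>n\<close> appends \<open>u\<close> or \<open>v\<close> according to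
  \<open>n \<in> B\<close>. Every walk spells an expansion of \<open>x\<close>. Distinct sets give
  distinct expansions: at the first stage where they differ both walks stand at the same point,
  after the same word, and append different words of equal length.\<close>

lemma continuum_if_branching:
  assumes S: "S \<subseteq> {0..q / (q - 1)}" and x: "x \<in> S"
    and branch: "\<And>y. y \<in> S \<Longrightarrow> \<exists>u v y1 y2. u \<in> lists {0, 1, q} \<and> v \<in> lists {0, 1, q} \<and>
       length u = length v \<and> u \<noteq> v \<and> y1 \<in> S \<and> y2 \<in> S \<and>
       y = prefix_map q u y1 \<and> y = prefix_map q v y2"
  shows "(UNIV :: nat set set) \<lesssim> q_expansions q x"
proof -
  obtain u v y1 y2 where uv: "\<And>y. y \<in> S \<Longrightarrow> u y \<in> lists {0, 1, q} \<and> v y \<in> lists {0, 1, q} \<and>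
       length (u y) = length (v y) \<and> u y \<noteq> v y \<and> y1 y \<in> S \<and> y2 y \<in> S \<and>
       y = prefix_map q (u y) (y1 y) \<and> y = prefix_map q (v y) (y2 y)"
    using branch by metis
  define word where "word b y = (if b then u y else v y)" for b y
  define succ where "succ b y = (if b then y1 y else y2 y)" for b y
  have word: "word b y \<in> lists {0, 1, q}" "succ b y \<in> S" "prefix_map q (word b y) (succ b y) = y"
    and len: "length (word b y) = length (u y)" and ne: "word True y \<noteq> word False y"
    if "y \<in> S" for b y
    using uv [OF that] by (auto simp: word_def succ_def)
  have pos: "0 < length (u y)" if "y \<in> S" for y
    using uv [OF that] by (cases "u y") auto
  \<comment> \<open>\<open>st B n\<close> is the point reached after \<open>n\<close> stages and
    \<open>W B n\<close> the word spelled so far.\<close>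
  define st where "st B = rec_nat x (\<lambda>n y. succ (n \<in> B) y)" for B :: "nat set"
  define W where "W B = rec_nat [] (\<lambda>n w. w @ word (n \<in> B) (st B n))" for B :: "nat set"
  have st: "st B 0 = x" "st B (Suc n) = succ (n \<in> B) (st B n)" for B n
    by (simp_all add: st_def)
  have W: "W B 0 = []" "W B (Suc n) = W B n @ word (n \<in> B) (st B n)" for B n
    by (simp_all add: W_def)
  have stS: "st B n \<in> S" for B n
    by (induction n) (use x word st in auto)
  have W_dig: "W B n \<in> lists {0, 1, q}" for B n
    by (induction n) (use word(1) stS W in auto)
  have W_pre: "x = prefix_map q (W B n) (st B n)" for B n
    by (induction n) (simp_all add: st W word(3) stS prefix_map_append)
  have W_len: "n \<le> length (W B n)" for B n
  proof (induction n)
    case (Suc n)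
    then show ?case using len [OF stS, of "n \<in> B" B n] pos [OF stS, of B n]
      by (simp add: W del: length_greater_0_conv)
  qed simp
  have W_ext: "\<exists>z. W B (n + k) = W B n @ z" for B n k
    by (induction k) (auto simp: W)
  \<comment> \<open>After \<open>Suc i\<close> stages the word has more than \<open>i\<close>
    letters, because the two distinct words of equal length at a point are nonempty; later stages
    only extend it.\<close>
  define d where "d B i = W B (Suc i) ! i" for B i
  have W_nth: "W B n ! i = d B i" if "i < length (W B n)" for B n i
  proof (cases "n \<le> Suc i")
    case True
    then obtain z where "W B (Suc i) = W B n @ z" using W_ext [of B n "Suc i - n"] by auto
    then show ?thesis using that by (simp add: d_def nth_append)
  next
    case False
    then obtain z where "W B n = W B (Suc i) @ z" using W_ext [of B "Suc i" "n - Suc i"] by auto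
    then show ?thesis using W_len [of "Suc i" B] by (simp add: d_def nth_append)
  qed
  have d_W: "map (d B) [0..<length (W B n)] = W B n" for B n
    by (rule nth_equalityI) (simp_all add: W_nth)
  have "d B \<in> q_expansions q x" for B
  proof (rule expansion_if_prefixes [OF q1, where N = "\<lambda>n. length (W B n)" and y = "st B"])
    fix i
    have "i < length (W B (Suc i))" using W_len [of "Suc i" B] by simp
    then show "d B i \<in> {0, 1, q}"
      unfolding d_def using W_dig [of B "Suc i"] by (meson in_listsD nth_mem)
  next
    fix n
    show "x = prefix_map q (map (d B) [0..<length (W B n)]) (st B n)"
      using W_pre d_W by simp
    show "st B n \<in> {0..q / (q - 1)}" using stS S by blast
  qed (rule W_len)
  moreover have "inj d"
  proof (rule injI, rule ccontr)
    fix B C assume BC: "d B = d C" "B \<noteq> C"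
    define n where "n = (LEAST n. (n \<in> B) \<noteq> (n \<in> C))"
    have n: "(n \<in> B) \<noteq> (n \<in> C)"
      unfolding n_def by (rule LeastI_ex) (use BC in auto)
    have less: "(m \<in> B) = (m \<in> C)" if "m < n" for m
      using not_less_Least that unfolding n_def by blast
    have stB: "m \<le> n \<Longrightarrow> st B m = st C m" for m
      by (induction m) (auto simp: st less)
    have WB: "m \<le> n \<Longrightarrow> W B m = W C m" for m
      by (induction m) (auto simp: W less stB)
    have "length (W B (Suc n)) = length (W C (Suc n))"
      using stB [of n] WB [of n] len [OF stS] by (simp add: W)
    then have "W B (Suc n) = W C (Suc n)"
      using d_W BC(1) by metis
    then have "word (n \<in> B) (st B n) = word (n \<in> C) (st B n)"
      using WB [of n] stB [of n] by (simp add: W)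
    then show False using n ne [OF stS, of B n] by (cases "n \<in> B") auto
  qed
  ultimately show ?thesis
    unfolding lepoll_def by blast
qed

text \<open>If no tail of \<open>x\<close> had a unique expansion, the set of all points with that
  property would be closed under tails, and each of its points would have two expansions. Cutting
  these behind a position where they differ gives the two words required by
  \<open>continuum_if_branching\<close>.\<close>

lemma continuum_or_unique_tail:
  assumes "x \<in> E_set q" "\<not> (UNIV :: nat set set) \<lesssim> q_expansions q x"
  shows "\<exists>w \<in> lists {0, 1, q}. \<exists>y \<in> E_set q. x = prefix_map q w y \<and> (\<exists>d. q_expansions q y = {d})"
proof (rule ccontr)
  assume no: "\<not> ?thesis"
  define S where "S = {y \<in> E_set q. \<forall>w\<in>lists {0, 1, q}. \<forall>z\<in>E_set q. y = prefix_map q w z \<longrightarrow>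
      \<not> (\<exists>d. q_expansions q z = {d})}"
  have sub: "z \<in> S" if "y \<in> S" "y = prefix_map q w z" "w \<in> lists {0, 1, q}" "z \<in> E_set q" for y w z
  proof -
    have "\<not> (\<exists>d. q_expansions q z' = {d})"
      if "v \<in> lists {0, 1, q}" "z' \<in> E_set q" "z = prefix_map q v z'" for v z'
    proof -
      have "w @ v \<in> lists {0, 1, q}" using \<open>w \<in> _\<close> that(1) by simp
      moreover have "y = prefix_map q (w @ v) z'"
        using \<open>y = _\<close> that(3) by (simp only: prefix_map_append)
      ultimately show ?thesis using \<open>y \<in> S\<close> that(2) unfolding S_def by blast
    qed
    then show ?thesis using \<open>z \<in> E_set q\<close> unfolding S_def by blast
  qed
  have "(UNIV :: nat set set) \<lesssim> q_expansions q x"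
  proof (rule continuum_if_branching [of S])
    show "S \<subseteq> {0..q / (q - 1)}" using E_bounds [OF q1] by (auto simp: S_def)
    show "x \<in> S" using assms(1) no by (auto simp: S_def)
  next
    fix y assume y: "y \<in> S"
    then have "y \<in> E_set q" and H: "\<And>w z. w \<in> lists {0, 1, q} \<Longrightarrow> z \<in> E_set q \<Longrightarrow>
        y = prefix_map q w z \<Longrightarrow> \<not> (\<exists>d. q_expansions q z = {d})"
      unfolding S_def by blast+
    moreover have "\<not> (\<exists>d. q_expansions q y = {d})"
      using H [of "[]" y] \<open>y \<in> E_set q\<close> by simp
    ultimately obtain d where d: "d \<in> q_expansions q y" "q_expansions q y \<noteq> {d}"
      unfolding E_set_def by blast
    then obtain e where de: "d \<in> q_expansions q y" "e \<in> q_expansions q y" "d \<noteq> e"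
      by blast
    then obtain i where i: "d i \<noteq> e i" by auto
    let ?u = "\<lambda>d :: nat \<Rightarrow> real. map d [0..<Suc i]"
    obtain y1 where y1: "y1 \<in> E_set q" "y = prefix_map q (?u d) y1"
      using expansion_shift [OF q1 de(1), of "Suc i"] by blast
    obtain y2 where y2: "y2 \<in> E_set q" "y = prefix_map q (?u e) y2"
      using expansion_shift [OF q1 de(2), of "Suc i"] by blast
    have dig: "?u d \<in> lists {0, 1, q}" "?u e \<in> lists {0, 1, q}"
      using de by (auto simp: q_expansions_def)
    moreover have "?u d \<noteq> ?u e" using i by simp
    ultimately show "\<exists>u v y1 y2. u \<in> lists {0, 1, q} \<and> v \<in> lists {0, 1, q} \<and>
       length u = length v \<and> u \<noteq> v \<and> y1 \<in> S \<and> y2 \<in> S \<and>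
       y = prefix_map q u y1 \<and> y = prefix_map q v y2"
      using y1 y2 sub [OF y y1(2)] sub [OF y y2(2)] by (metis length_map)
  qed
  then show False using assms(2) by blast
qed

text \<open>The branching set consists of the points having an expansion with infinitely many swap
  spots. Exchanging \<open>0q\<close> and \<open>10\<close> at one spot keeps the tail, in which
  infinitely many spots remain, so both branches return to the set.\<close>

lemma continuum_if_swap_spots:
  assumes "d \<in> q_expansions q x" "infinite {i. swap_spot q d i}"
  shows "(UNIV :: nat set set) \<lesssim> q_expansions q x"
proof (rule continuum_if_branching [of "{y. \<exists>d \<in> q_expansions q y. infinite {i. swap_spot q d i}}"])
  let ?S = "{y. \<exists>d \<in> q_expansions q y. infinite {i. swap_spot q d i}}"
  show "?S \<subseteq> {0..q / (q - 1)}" using expansion_bounds [OF q1] by auto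
  show "x \<in> ?S" using assms by blast
  fix y assume "y \<in> ?S"
  then obtain d where d: "d \<in> q_expansions q y" "infinite {i. swap_spot q d i}" by blast
  then obtain i where i: "swap_spot q d i" using not_finite_existsD by blast
  let ?w = "map d [0..<i]"
  obtain z where z: "y = prefix_map q (map d [0..<i + 2]) z"
      "(\<lambda>j. d (j + (i + 2))) \<in> q_expansions q z"
    using expansion_shift [OF q1 d(1), of "i + 2"] by blast
  have "infinite {j. swap_spot q (\<lambda>j. d (j + (i + 2))) j}"
  proof
    assume fin: "finite {j. swap_spot q (\<lambda>j. d (j + (i + 2))) j}"
    have "{j. swap_spot q d j} \<subseteq> {..<i + 2} \<union> (\<lambda>j. j + (i + 2)) ` {j. swap_spot q (\<lambda>j. d (j + (i + 2))) j}"
    proof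
      fix j assume "j \<in> {j. swap_spot q d j}"
      then show "j \<in> {..<i + 2} \<union> (\<lambda>j. j + (i + 2)) ` {j. swap_spot q (\<lambda>j. d (j + (i + 2))) j}"
        unfolding swap_spot_shift
        by (cases "j < i + 2")
          (auto simp del: add_2_eq_Suc' intro!: image_eqI [of _ _ "j - (i + 2)"])
    qed
    then show False using d(2) fin by (meson finite_UnI finite_imageI finite_lessThan finite_subset)
  qed
  then have zS: "z \<in> ?S" using z(2) by blast
  have w: "?w \<in> lists {0, 1, q}" using d(1) by (auto simp: q_expansions_def)
  have "map d [0..<i + 2] = ?w @ [d i, d (Suc i)]" by simp
  moreover have "prefix_map q [0, q] z = prefix_map q [1, 0] z" using q1 by (simp add: field_simps)
  ultimately have "y = prefix_map q (?w @ [0, q]) z" "y = prefix_map q (?w @ [1, 0]) z"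
    using i z(1) by (auto simp: prefix_map_append swap_spot_def)
  moreover have "?w @ [0, q] \<in> lists {0, 1, q}" "?w @ [1, 0] \<in> lists {0, 1, q}" using w by auto
  ultimately show "\<exists>u v y1 y2. u \<in> lists {0, 1, q} \<and> v \<in> lists {0, 1, q} \<and>
       length u = length v \<and> u \<noteq> v \<and> y1 \<in> ?S \<and> y2 \<in> ?S \<and>
       y = prefix_map q u y1 \<and> y = prefix_map q v y2"
    using zS by (intro exI [of _ "?w @ [0, q]"] exI [of _ "?w @ [1, 0]"] exI [of _ z]) auto
qed

section \<open>Tails of unique expansions and bounded invariant sets\<close>

lemma unique_expansion_step:
  assumes "q_expansions q x = {d}" "a \<in> {0, 1, q}" "q * x - a \<in> E_set q"
  shows "\<exists>e. q_expansions q (q * x - a) = {e}" "a = d 0"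
proof -
  have eq: "case_nat a e = d" if "e \<in> q_expansions q (q * x - a)" for e
    using expansion_case_nat [OF q1 assms(2) that] assms(1) by simp
  obtain e where e: "e \<in> q_expansions q (q * x - a)" using assms(3) by (auto simp: E_set_def)
  have "e' = e" if "e' \<in> q_expansions q (q * x - a)" for e'
  proof
    fix i
    show "e' i = e i" using fun_cong [OF eq [OF that], of "Suc i"] fun_cong [OF eq [OF e], of "Suc i"] by simp
  qed
  then show "\<exists>e. q_expansions q (q * x - a) = {e}" using e by blast
  show "a = d 0" using fun_cong [OF eq [OF e], of 0] by simp
qed

text \<open>The map \<open>\<lambda>x. p + q * (x - p)\<close> fixes \<open>p\<close> and multiplies
  distances to \<open>p\<close> by \<open>q\<close>, so all its other orbits are unbounded. In use
  it is \<open>\<lambda>x. q * x - a\<close> rewritten around its fixed point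
  \<open>p = a / (q - 1)\<close>.\<close>

lemma expanding_invariant_trivial:
  assumes bd: "A \<subseteq> {0..b}" and inv: "\<And>x. x \<in> A \<Longrightarrow> p + q * (x - p) \<in> A" and "x \<in> A"
  shows "x = p"
proof (rule ccontr)
  assume "x \<noteq> p"
  have A: "p + q ^ n * (x - p) \<in> A" for n
  proof (induction n)
    case (Suc n)
    then show ?case using inv [OF Suc] by (simp add: mult.assoc)
  qed (use \<open>x \<in> A\<close> in simp)
  obtain n where "(\<bar>b\<bar> + \<bar>p\<bar>) / \<bar>x - p\<bar> < q ^ n" using real_arch_pow [OF q1] by blast
  then have "\<bar>b\<bar> + \<bar>p\<bar> < \<bar>q ^ n * (x - p)\<bar>"
    using \<open>x \<noteq> p\<close> q1 by (simp add: pos_divide_less_eq abs_mult)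
  then show False using A [of n] bd by (auto simp: subset_iff abs_if split: if_splits)
qed

end

section \<open>Countably many expansions\<close>

lemma eqpoll_nat_iff: "A \<approx> (UNIV :: nat set) \<longleftrightarrow> countable A \<and> infinite A"
proof
  assume "A \<approx> (UNIV :: nat set)"
  then obtain f where "bij_betw f A (UNIV :: nat set)" by (auto simp: eqpoll_def)
  then show "countable A \<and> infinite A"
    by (metis bij_betw_finite bij_betw_imp_inj_on countableI infinite_UNIV_nat)
next
  assume "countable A \<and> infinite A"
  then have "bij_betw (to_nat_on A) A UNIV" by (auto intro: to_nat_on_infinite)
  then show "A \<approx> (UNIV :: nat set)" by (auto simp: eqpoll_def)
qed

lemma U_nat_iff:
  "x \<in> U_set q (UNIV :: nat set) \<longleftrightarrow> countable (q_expansions q x) \<and> infinite (q_expansions q x)"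
  unfolding U_set_def E_set_def eqpoll_nat_iff by auto

context
  fixes q :: real
  assumes q1: "1 < q"
begin

lemma expansions_Union:
  "q_expansions q x = (\<Union>a\<in>{0, 1, q}. case_nat a ` q_expansions q (q * x - a))"
proof (intro equalityI subsetI)
  fix d assume "d \<in> q_expansions q x"
  then have "d 0 \<in> {0, 1, q}" "(\<lambda>i. d (Suc i)) \<in> q_expansions q (q * x - d 0)"
    using expansion_iff [OF q1] by blast+
  moreover have "d = case_nat (d 0) (\<lambda>i. d (Suc i))" by (auto split: nat.split)
  ultimately show "d \<in> (\<Union>a\<in>{0, 1, q}. case_nat a ` q_expansions q (q * x - a))" by blast
qed (use expansion_case_nat [OF q1] in blast)

lemma inj_case_nat: "inj (case_nat a)"
proof (rule injI, rule ext)
  fix f g :: "nat \<Rightarrow> 'a" and i assume "case_nat a f = case_nat a g"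
  from fun_cong [OF this, of "Suc i"] show "f i = g i" by simp
qed

lemma infinite_expansions_bounds:
  assumes "infinite (q_expansions q x)"
  shows "0 < x" "x < q / (q - 1)" "x \<in> E_set q"
proof -
  show E: "x \<in> E_set q" using assms by (auto simp: E_set_def)
  have "x \<noteq> 0" "x \<noteq> q / (q - 1)"
    using assms expansions_zero [OF q1] expansions_top [OF q1] by (auto dest: finite_subset)
  then show "0 < x" "x < q / (q - 1)" using E_bounds [OF q1 E] by auto
qed

lemma countable_U_if_unique_trivial:
  assumes "\<And>y d. q_expansions q y = {d} \<Longrightarrow> y \<in> {0, q / (q - 1)}"
  shows "countable {x \<in> E_set q. \<not> (UNIV :: nat set set) \<lesssim> q_expansions q x}"
proof (rule countable_subset)
  show "{x \<in> E_set q. \<not> (UNIV :: nat set set) \<lesssim> q_expansions q x}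
      \<subseteq> {prefix_map q w y | w y. w \<in> lists {0, 1, q} \<and> y \<in> {0, q / (q - 1)}}"
    using continuum_or_unique_tail [OF q1] assms by blast
qed (rule countable_prefix_images, simp)

text \<open>For \<open>y < 1\<close> the point \<open>y / q\<close> can only start with 0, so it
  inherits the expansions of \<open>y\<close> and is a smaller member. For \<open>1 \<le> y\<close>
  the point \<open>y / q + 1\<close> inherits them behind a \<open>q\<close>, with at most finitely
  many others added, and is a larger member. A finite set would contain a least member below 1 or a
  greatest one from 1 on.\<close>

lemma infinite_U:
  assumes "2 \<le> q" "x \<in> U_set q (UNIV :: nat set)"
  shows "infinite (U_set q (UNIV :: nat set))"
proof
  let ?U = "U_set q (UNIV :: nat set)"
  assume fin: "finite ?U"
  define c where "c = 1 / (q - 1)"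
  have c: "q / (q - 1) = 1 + c" "0 < c" "c \<le> 1" "q * c = 1 + c"
    using assms(1) by (auto simp: c_def field_simps)
  have low: "y / q \<in> ?U" if "y \<in> ?U" "y < 1" for y
  proof -
    have "q_expansions q (y - 1) = {}" "q_expansions q (y - q) = {}"
      using that expansion_bounds(1) [OF q1] assms(1) by fastforce+
    then have "q_expansions q (y / q) = case_nat 0 ` q_expansions q y"
      using q1 by (subst expansions_Union) simp
    then show ?thesis
      using that(1) unfolding U_nat_iff by (simp add: finite_image_iff [OF inj_on_subset [OF inj_case_nat]])
  qed
  have high: "y / q + 1 \<in> ?U" if y: "y \<in> ?U" "1 \<le> y" for y
  proof -
    have a0: "q_expansions q (y + q) = {}"
      using that expansion_bounds(2) [OF q1] assms(1) c by fastforce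
    \<comment> \<open>The remainder \<open>y + q - 1\<close> is at least \<open>q\<close>, hence at
      least the right end point \<open>1 + c\<close>; only equality leaves an expansion, and then at
      most one.\<close>
    have a1: "finite (q_expansions q (y + q - 1))"
    proof (cases "y + q - 1 = q / (q - 1)")
      case True
      then show ?thesis using expansions_top [OF q1] by (auto dest: finite_subset)
    next
      case False
      then have "q_expansions q (y + q - 1) = {}"
        using that expansion_bounds(2) [OF q1] assms(1) c by fastforce
      then show ?thesis by simp
    qed
    have "q * (y / q + 1) = y + q" using q1 by (simp add: field_simps)
    then have "q_expansions q (y / q + 1) =
        case_nat 1 ` q_expansions q (y + q - 1) \<union> case_nat q ` q_expansions q y"
      by (subst expansions_Union) (simp add: a0)
    then show ?thesis
      using y(1) a1 unfolding U_nat_iff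
      by (simp add: finite_image_iff [OF inj_on_subset [OF inj_case_nat]] countable_finite)
  qed
  show False
  proof (cases "x < 1")
    case True
    let ?A = "{y \<in> ?U. y < 1}"
    have A: "finite ?A" "?A \<noteq> {}" using fin True assms(2) by auto
    define m where "m = Min ?A"
    have m: "m \<in> ?A" unfolding m_def using A by (rule Min_in)
    then have "0 < m" using infinite_expansions_bounds U_nat_iff by blast
    then have "m / q < m" using q1 by (simp add: field_simps)
    moreover have "m / q \<in> ?A" using m low [of m] \<open>m / q < m\<close> by auto
    then have "m \<le> m / q" unfolding m_def by (rule Min_le [OF A(1)])
    ultimately show False by simp
  next
    case False
    let ?A = "{y \<in> ?U. 1 \<le> y}"
    have A: "finite ?A" "?A \<noteq> {}" using fin False assms(2) by auto
    define m where "m = Max ?A"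
    have m: "m \<in> ?A" unfolding m_def using A by (rule Max_in)
    then have "m < q / (q - 1)" using infinite_expansions_bounds U_nat_iff by blast
    then have "m < m / q + 1" using q1 by (simp add: field_simps)
    moreover have "m / q + 1 \<in> ?A" using m high [of m] \<open>m < m / q + 1\<close> by auto
    then have "m / q + 1 \<le> m" unfolding m_def by (rule Max_ge [OF A(1)])
    ultimately show False by simp
  qed
qed

text \<open>Multiplication by \<open>q\<close> has the range from \<open>b / q\<close> to
  \<open>b\<close> as a fundamental domain, and the least \<open>k\<close> beyond its lower end
  works. This serves to strip leading zeros, or leading \<open>q\<close>s, until a point enters a
  region where two digits are possible.\<close>

lemma ex_scaling:
  assumes "0 < t" "t \<le> b"
  shows "\<exists>k::nat. b / q < q ^ k * t \<and> q ^ k * t \<le> b"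
proof -
  define P where "P k \<longleftrightarrow> b / q < q ^ k * t" for k
  obtain n where "b / q / t < q ^ n" using real_arch_pow [OF q1] by blast
  then have "P n" unfolding P_def using assms(1) pos_divide_less_eq by blast
  then have L: "P (LEAST k. P k)" by (rule LeastI)
  show ?thesis
  proof (cases "LEAST k. P k")
    case 0
    then show ?thesis using L assms by (intro exI [of _ 0]) (simp add: P_def)
  next
    case (Suc j)
    then have "\<not> P j" by (metis lessI not_less_Least)
    then have "q ^ Suc j * t \<le> b" using q1 by (simp add: P_def field_simps)
    moreover have "b / q < q ^ Suc j * t" using L Suc by (simp add: P_def)
    ultimately show ?thesis by blast
  qed
qed

lemma prefix_map_replicate_0: "prefix_map q (replicate k 0) y = y / q ^ k"
  by (induction k) simp_all

lemma prefix_map_replicate_top: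
  "q / (q - 1) - prefix_map q (replicate k q) y = (q / (q - 1) - y) / q ^ k"
proof (induction k)
  case (Suc k)
  have "q / (q - 1) - (q + z) / q = (q / (q - 1) - z) / q" for z
    using q1 by (simp add: field_simps)
  then show ?case using Suc by simp
qed simp

text \<open>For \<open>q < 2\<close> the number \<open>c = 1 / (q - 1)\<close> exceeds 1. Digits 0
  and 1 both lead to interior points if \<open>q * z\<close> lies strictly between 1 and
  \<open>1 + c\<close>, digits 1 and \<open>q\<close> if it lies strictly between \<open>q\<close>
  and \<open>2 + c\<close>. Every interior point reaches one of these regions after some leading
  zeros or some leading \<open>q\<close>s, so the open interval is a branching set.\<close>

lemma continuum_small_base:
  assumes "q < 2" "0 < x" "x < q / (q - 1)"
  shows "(UNIV :: nat set set) \<lesssim> q_expansions q x"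
proof (rule continuum_if_branching [OF q1, of "{0<..<q / (q - 1)}"])
  define c where "c = 1 / (q - 1)"
  have c: "q / (q - 1) = 1 + c" "1 < c" "q * c = 1 + c"
    using assms(1) q1 by (auto simp: c_def field_simps)
  fix y assume y: "y \<in> {0<..<q / (q - 1)}"
  let ?goal = "\<exists>u v y1 y2. u \<in> lists {0, 1, q} \<and> v \<in> lists {0, 1, q} \<and>
       length u = length v \<and> u \<noteq> v \<and> y1 \<in> {0<..<q / (q - 1)} \<and> y2 \<in> {0<..<q / (q - 1)} \<and>
       y = prefix_map q u y1 \<and> y = prefix_map q v y2"
  have two: ?goal
    if "w \<in> lists {0, 1, q}" "y = prefix_map q w z" "a \<in> {0, 1, q}" "b \<in> {0, 1, q}" "a \<noteq> b"
      "q * z - a \<in> {0<..<q / (q - 1)}" "q * z - b \<in> {0<..<q / (q - 1)}" for w z a b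
  proof (intro exI conjI)
    show "y = prefix_map q (w @ [a]) (q * z - a)" "y = prefix_map q (w @ [b]) (q * z - b)"
      using that(2) q1 by (simp_all add: prefix_map_append)
  qed (use that in auto)
  consider "y \<le> 1" | "1 < y" "q * y < 2 + c" | "2 + c \<le> q * y" by linarith
  then show ?goal
  proof cases
    case 1
    then obtain k where k: "1 / q < q ^ k * y" "q ^ k * y \<le> 1"
      using ex_scaling [of y 1] y by auto
    let ?z = "q ^ k * y"
    have "y = prefix_map q (replicate k 0) ?z"
      using q1 by (simp add: prefix_map_replicate_0)
    moreover have "1 < q * ?z" using k(1) q1 by (simp add: pos_divide_less_eq mult.commute)
    moreover have "q * ?z \<le> q * 1" using k(2) q1 by (intro mult_left_mono) auto
    ultimately show ?thesis
      using c assms(1) by (intro two [of "replicate k 0" ?z 0 1]) auto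
  next
    case 2
    have "q * 1 < q * y" using 2 q1 by (intro mult_strict_left_mono) auto
    then have "q < q * y" "1 < q * y" using q1 by linarith+
    then show ?thesis
      using 2 c assms(1) q1 by (intro two [of "[]" y 1 q]) auto
  next
    case 3
    let ?M = "q / (q - 1)"
    have qM: "q * ?M = ?M + q" using q1 by (simp add: field_simps)
    have "0 < (q - 1) * (q - 1)" using q1 by simp
    then have qq: "q - 1 < q * (q - 1)" "2 * q < q * q + 1" by (auto simp: algebra_simps)
    have "q * (?M - y) \<le> q - 1" using 3 c(1) qM by (simp add: right_diff_distrib)
    then have "q * (?M - y) \<le> q * (q - 1)" using qq by linarith
    then have "?M - y \<le> q - 1" using q1 by simp
    \<comment> \<open>Distances to \<open>?M\<close> in this range mean that \<open>q * z\<close> is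
      at least \<open>?M + q - q * (q - 1)\<close> and below \<open>?M + 1\<close>; this is inside
      the region of the digits 1 and \<open>q\<close> because \<open>q - 1 < c\<close>.\<close>
    then obtain k where k: "(q - 1) / q < q ^ k * (?M - y)" "q ^ k * (?M - y) \<le> q - 1"
      using ex_scaling [of "?M - y" "q - 1"] y by auto
    define z where "z = ?M - q ^ k * (?M - y)"
    have "?M - prefix_map q (replicate k q) z = ?M - y"
      using q1 by (simp add: prefix_map_replicate_top z_def)
    then have "y = prefix_map q (replicate k q) z" by simp
    moreover have "q - 1 < q * (q ^ k * (?M - y))"
      using k(1) q1 by (simp add: pos_divide_less_eq mult.commute)
    then have "q * z < 2 + c" unfolding z_def right_diff_distrib qM using c(1) by simp
    moreover have "q * (q ^ k * (?M - y)) \<le> q * (q - 1)"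
      using k(2) q1 by (intro mult_left_mono) auto
    then have "1 + c + q - q * (q - 1) \<le> q * z" unfolding z_def right_diff_distrib qM using c(1) by simp
    moreover have "q * (q - 1) < q * c" using c assms(1) q1 by (intro mult_strict_left_mono) auto
    then have "q < q * z" "1 < q * z"
      using \<open>1 + c + q - q * (q - 1) \<le> q * z\<close> c(3) q1 by linarith+
    moreover from this have "1 < z" using q1 by simp
    ultimately show ?thesis
      using c assms(1) q1 by (intro two [of "replicate k q" z 1 q]) auto
  qed
qed (use assms in auto)

text \<open>A point with a unique expansion lies in one of three regions with a forced first digit:
  \<open>q * y < 1\<close> for 0, \<open>c < y \<and> y < 1\<close> for 1, and
  \<open>2 + c < q * y\<close> for \<open>q\<close>. For \<open>q \<le> q_c\<close> the points of
  \<open>U\<close> in each region are mapped into that region by its own digit, so only the fixed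
  points 0, \<open>c\<close> and \<open>1 + c\<close> could remain, and \<open>c\<close> is outside
  its region.\<close>

lemma unique_trivial_small_base:
  assumes "q \<le> q_c" "q_expansions q x = {d}"
  shows "x \<in> {0, q / (q - 1)}"
proof -
  define c where "c = 1 / (q - 1)"
  have c: "q / (q - 1) = 1 + c" "0 < c" "q * c = 1 + c"
    using q1 by (auto simp: c_def field_simps)
  have qstar: "q \<le> q_star" using assms(1) q_c_less_q_star by simp
  \<comment> \<open>This is \<open>q \<le> q_c\<close> in the form
    \<open>q * (q - 2) * (q - 1) \<le> 1\<close>; the product increases beyond 2 and equals 1 at
    \<open>q_c\<close>.\<close>
  have key: "q * (q - 2) \<le> c"
  proof (cases "q \<le> 2")
    case True
    then have "q * (q - 2) \<le> 0" using q1 by (intro mult_nonneg_nonpos) auto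
    then show ?thesis using c by simp
  next
    case False
    have "q * (q - 2) * (q - 1) \<le> q_c * (q_c - 2) * (q_c - 1)"
      using False assms(1) by (intro mult_mono) auto
    also have "\<dots> = 1" using q_c_root by (simp add: algebra_simps power2_eq_square power3_eq_cube)
    finally show ?thesis unfolding c_def using q1 by (simp add: pos_le_divide_eq)
  qed
  have "q\<^sup>2 - 3 * q + 1 \<le> 0" using q_star_quadratic [OF q1] qstar by simp
  then have "(q - 2) * (q - 1) \<le> 1" by (simp add: algebra_simps power2_eq_square)
  then have "q - 2 \<le> c" unfolding c_def using q1 by (simp add: pos_le_divide_eq)
  then have qc2: "q \<le> 2 + c" by simp
  define U where "U = {y. \<exists>d. q_expansions q y = {d}}"
  have U_E: "y \<in> E_set q" if "y \<in> U" for y using that by (auto simp: U_def E_set_def)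
  have U_bd: "0 \<le> y" "y \<le> 1 + c" if "y \<in> U" for y using E_bounds [OF q1 U_E [OF that]] c by auto
  have E: "E_set q = {0..1 + c}" using E_eq_interval [OF q1 qstar] c by simp
  have step: "q * y - a \<in> U" if "y \<in> U" "a \<in> {0, 1, q}" "0 \<le> q * y - a" "q * y - a \<le> 1 + c" for y a
    using that unique_expansion_step(1) [OF q1, of y _ a] E by (auto simp: U_def)
  have only: "a = b" if "y \<in> U" "a \<in> {0, 1, q}" "0 \<le> q * y - a" "q * y - a \<le> 1 + c"
      "b \<in> {0, 1, q}" "0 \<le> q * y - b" "q * y - b \<le> 1 + c" for y a b
  proof -
    obtain e where e: "q_expansions q y = {e}" using \<open>y \<in> U\<close> by (auto simp: U_def)
    have "a = e 0" "b = e 0" using that E by (intro unique_expansion_step(2) [OF q1 e]; simp)+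
    then show ?thesis by simp
  qed
  have not01: "\<not> (1 \<le> q * y \<and> q * y \<le> 1 + c)" if "y \<in> U" for y
    using only [OF that, of 0 1] by auto
  have not1q: "\<not> (q \<le> q * y \<and> q * y \<le> 2 + c)" if "y \<in> U" for y
    using only [OF that, of 1 q] q1 by auto
  have mono: "q * y \<le> q * z \<longleftrightarrow> y \<le> z" for y z using q1 by simp
  have mono': "q * y < q * z \<longleftrightarrow> y < z" for y z using q1 by simp
  have no_mid: "\<not> (c < y \<and> y < 1)" if "y \<in> U" for y
  proof
    assume "c < y \<and> y < 1"
    moreover have "c + q * (y - c) \<in> {y \<in> U. c < y \<and> y < 1}"
      if "y \<in> {y \<in> U. c < y \<and> y < 1}" for y
    proof -
      have y: "y \<in> U" "1 + c < q * y" "q * y < q" using that mono' [of c y] mono' [of y 1] c by auto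
      have z: "c + q * (y - c) = q * y - 1" using c by (simp add: right_diff_distrib)
      have zU: "q * y - 1 \<in> U" using y c qc2 by (intro step) auto
      \<comment> \<open>Otherwise this remainder takes the digit \<open>q\<close>, and
        \<open>key\<close> puts \<open>q\<close> times the next remainder between 1 and
        \<open>1 + c\<close>, where 0 and 1 are both possible.\<close>
      have "q * y - 1 < 1"
      proof (rule ccontr)
        define z where "z = q * y - 1"
        assume "\<not> q * y - 1 < 1"
        then have "z \<in> U" "1 \<le> z" "z < q - 1" using zU y by (auto simp: z_def)
        then have "q \<le> q * z" "q * z < q * (q - 1)" using mono [of 1 z] mono' [of z "q - 1"] by auto
        moreover from this have "2 + c < q * z" using not1q [OF \<open>z \<in> U\<close>] by auto
        moreover have "q * (q - 1) = q * (q - 2) + q" by (simp add: algebra_simps)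
        ultimately have w: "2 + c - q < q * z - q" "q * z - q \<le> c" "0 \<le> q * z - q" using key by auto
        have wU: "q * z - q \<in> U" using \<open>z \<in> U\<close> w by (intro step) auto
        have "q * (2 + c - q) < q * (q * z - q)" "q * (q * z - q) \<le> q * c" using mono mono' w by auto
        moreover have "q * (2 + c - q) = (1 + c) - q * (q - 2)" using c by (simp add: algebra_simps)
        ultimately show False using not01 [OF wU] key c by auto
      qed
      then show ?thesis using z zU y by simp
    qed
    ultimately have "y = c"
      using that U_bd by (intro expanding_invariant_trivial [OF q1, of "{y \<in> U. c < y \<and> y < 1}" "1 + c"]) auto
    then show False using \<open>c < y \<and> y < 1\<close> by simp
  qed
  have left: "y = 0" if "y \<in> U" "q * y < 1" for y
  proof (rule expanding_invariant_trivial [OF q1, of "{y \<in> U. q * y < 1}" "1 + c"])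
    show "{y \<in> U. q * y < 1} \<subseteq> {0..1 + c}" using U_bd by auto
    show "y \<in> {y \<in> U. q * y < 1}" using that by simp
    fix y assume "y \<in> {y \<in> U. q * y < 1}"
    then have y: "y \<in> U" "q * y < 1" by auto
    then have "q * y - 0 \<in> U" using U_bd [of y] q1 c by (intro step) auto
    then have z: "q * y \<in> U" by simp
    have "q * (q * y) < 1"
      using not01 [OF z] no_mid [OF z] y mono [of "q * y" c] c by linarith
    then show "0 + q * (y - 0) \<in> {y \<in> U. q * y < 1}" using z by simp
  qed
  have right: "y = 1 + c" if "y \<in> U" "2 + c < q * y" for y
  proof (rule expanding_invariant_trivial [OF q1, of "{y \<in> U. 2 + c < q * y}" "1 + c"])
    show "{y \<in> U. 2 + c < q * y} \<subseteq> {0..1 + c}" using U_bd by auto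
    show "y \<in> {y \<in> U. 2 + c < q * y}" using that by simp
    fix y assume "y \<in> {y \<in> U. 2 + c < q * y}"
    then have y: "y \<in> U" "2 + c < q * y" by auto
    have "q * y \<le> q * (1 + c)" using U_bd [OF y(1)] mono by simp
    moreover have "q * 1 < q * y" using y qc2 by simp
    then have "1 < y" using mono' by blast
    ultimately have z: "q * y - q \<in> U" using y qc2 c by (intro step) (auto simp: distrib_left)
    have eq: "1 + c + q * (y - (1 + c)) = q * y - q" using c by (simp add: algebra_simps)
    \<comment> \<open>By \<open>key\<close> the remainder misses the left region; the overlaps and
      the middle region are excluded, so it lies in the right region again.\<close>
    have "q * (2 + c - q) < q * (q * y - q)" using mono' y by simp
    moreover have "q * (2 + c - q) = (1 + c) - q * (q - 2)" using c by (simp add: algebra_simps)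
    ultimately have "1 < q * (q * y - q)" using key by simp
    then have "2 + c < q * (q * y - q)"
      using not01 [OF z] not1q [OF z] no_mid [OF z] mono [of "q * y - q" c] mono [of 1 "q * y - q"] c
      by linarith
    then show "1 + c + q * (y - (1 + c)) \<in> {y \<in> U. 2 + c < q * y}" using z eq by simp
  qed
  have x: "x \<in> U" using assms(2) by (auto simp: U_def)
  consider "q * x < 1" | "2 + c < q * x" | "1 \<le> q * x" "q * x \<le> 2 + c" by linarith
  then show ?thesis
  proof cases
    case 3
    then show ?thesis
      using not01 [OF x] not1q [OF x] no_mid [OF x] mono [of x c] mono [of 1 x] c by linarith
  qed (use left right x c in auto)
qed

text \<open>Follow remainders that keep infinitely many expansions. Somewhere beyond the last swap
  spot a second digit must be possible; from there on all digits are 1 and the alternative 0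
  persists. The remainder then stays bounded under \<open>\<lambda>y. q * y - 1\<close>, hence
  equals \<open>1 / (q - 1)\<close>.\<close>

lemma tail_ones_if_few_swap_spots:
  assumes "q_star \<le> q" "infinite (q_expansions q x)"
    and few: "\<And>d. d \<in> q_expansions q x \<Longrightarrow> finite {i. swap_spot q d i}"
  shows "\<exists>w\<in>lists {0, 1, q}. x = prefix_map q w (1 / (q - 1))"
proof -
  define c where "c = 1 / (q - 1)"
  have c: "q / (q - 1) = 1 + c" "0 < c" "q * c = 1 + c"
    using q1 by (auto simp: c_def field_simps)
  have "0 \<le> q\<^sup>2 - 3 * q + 1"
    using q_star_root q_star_quadratic [OF q1] assms(1) by (cases "q = q_star") auto
  then have "1 \<le> (q - 2) * (q - 1)" by (simp add: algebra_simps power2_eq_square)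
  then have "c \<le> q - 2" unfolding c_def using q1 by (simp add: pos_divide_le_eq)
  moreover have "2 < q" using assms(1) q_star_gt_2 by simp
  ultimately have qc: "2 + c \<le> q" "c < 1" unfolding c_def by auto
  let ?S = "{y. infinite (q_expansions q y)}"
  \<comment> \<open>Koenig's argument: at least one of the three digits leads to a point that again
    has infinitely many expansions.\<close>
  have "\<exists>d \<in> q_expansions q x. \<exists>r. r 0 = x \<and> (\<forall>n. r n \<in> ?S \<and> True \<and> r (Suc n) = q * r n - d n)"
  proof (rule E_if_closed [OF q1])
    fix y assume "y \<in> ?S"
    then have "infinite (\<Union>a\<in>{0, 1, q}. case_nat a ` q_expansions q (q * y - a))"
      using expansions_Union [of y] by simp
    then obtain a where "a \<in> {0, 1, q}" "infinite (q_expansions q (q * y - a))" by blast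
    then show "\<exists>a\<in>{0, 1, q}. True \<and> q * y - a \<in> ?S" by blast
  next
    show "?S \<subseteq> {0..q / (q - 1)}"
      by (auto intro!: infinite_expansions_bounds(1,2) [THEN less_imp_le])
    show "x \<in> ?S" using assms(2) by simp
  qed
  then obtain d r where d: "d \<in> q_expansions q x" and r: "r 0 = x" "\<And>n. infinite (q_expansions q (r n))"
      "\<And>n. r (Suc n) = q * r n - d n"
    by blast
  have r_bd: "0 < r n" "r n < 1 + c" for n using infinite_expansions_bounds [OF r(2)] c by auto
  have dig: "d n \<in> {0, 1, q}" for n using d by (auto simp: q_expansions_def)
  obtain N where N: "\<And>i. N \<le> i \<Longrightarrow> \<not> swap_spot q d i"
    using few [OF d] unfolding finite_nat_set_iff_bounded by (metis mem_Collect_eq not_le)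
  \<comment> \<open>As \<open>2 + c \<le> q\<close>, only 0 and 1 can compete. If
    \<open>d m = 0\<close>, the alternative 1 forces \<open>d (Suc m) = q\<close>, a swap spot. If
    \<open>d m = 1\<close>, the alternative 0 must continue with \<open>q\<close>, and exchanging
    \<open>0q\<close> for \<open>10\<close> shows that 0 is possible after the 1; taking it would be
    a swap spot and \<open>q\<close> is too large there, so the next digit is 1.\<close>
  have branch: "d m = 1 \<and> d (Suc m) = 1 \<and> q * r (Suc m) - 0 \<in> E_set q"
    if m: "N \<le> m" and a: "a \<in> {0, 1, q}" "a \<noteq> d m" "q * r m - a \<in> E_set q" for m a
  proof -
    let ?y = "r m" and ?z = "r (Suc m)"
    have y: "?z = q * ?y - d m" "r (Suc (Suc m)) = q * ?z - d (Suc m)" using r(3) by auto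
    have yE: "0 \<le> q * ?y - a" "q * ?y - a \<le> 1 + c" using E_bounds [OF q1 a(3)] c by auto
    have no: "\<not> (d m = 0 \<and> d (Suc m) = q)" "\<not> (d m = 1 \<and> d (Suc m) = 0)"
      using N [OF m] by (auto simp: swap_spot_def)
    consider "d m = 0" | "d m = 1" | "d m = q" using dig by blast
    then show ?thesis
    proof cases
      case 1
      have "q * ?y < 1 + c" using y 1 r_bd(2) [of "Suc m"] by simp
      then have "a = 1" using a(1,2) 1 yE qc q1 by auto
      then have "1 \<le> ?z" using yE y 1 by simp
      then have "q * 1 \<le> q * ?z" using q1 by (intro mult_left_mono) auto
      then have "d (Suc m) = q" using dig [of "Suc m"] y(2) r_bd(2) [of "Suc (Suc m)"] qc by auto
      then show ?thesis using no 1 by simp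
    next
      case 2
      have lt: "q * ?y < 2 + c" using y 2 r_bd(2) [of "Suc m"] by simp
      then have a0: "a = 0" using a(1,2) 2 yE qc q1 by auto
      then have qyE: "q * ?y \<in> E_set q" "?z \<le> c" using a(3) yE y 2 by auto
      then obtain e where e: "e \<in> q_expansions q (q * ?y)" by (auto simp: E_set_def)
      have e0: "q * (q * ?y) - e 0 \<in> E_set q" "e 0 \<in> {0, 1, q}" using E_unstep [OF q1 e] by auto
      have "1 < q * ?y" using r_bd(1) [of "Suc m"] y 2 by simp
      then have "q * 1 < q * (q * ?y)" using q1 by (intro mult_strict_left_mono) auto
      moreover have "q * (q * ?y) - e 0 \<le> 1 + c" using E_bounds(2) [OF q1 e0(1)] c by simp
      ultimately have "1 < e 0" using qc by linarith
      then have "e 0 = q" using e0(2) by auto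
      then have zE: "q * ?z - 0 \<in> E_set q" using e0(1) y(1) 2 by (simp add: right_diff_distrib)
      have "d (Suc m) \<noteq> q"
      proof
        assume "d (Suc m) = q"
        then have "q * 1 < q * ?z" using y(2) r_bd(1) [of "Suc (Suc m)"] by simp
        then have "1 < ?z" using q1 by simp
        then show False using qyE qc by simp
      qed
      then show ?thesis using dig [of "Suc m"] no 2 zE by auto
    next
      case 3
      have "q < q * ?y" using y 3 r_bd(1) [of "Suc m"] by simp
      then have "1 < a" using yE(2) qc by linarith
      then show ?thesis using a(1,2) 3 by auto
    qed
  qed
  have shift: "(\<lambda>i. d (i + n)) \<in> q_expansions q (r n) \<and> x = prefix_map q (map d [0..<n]) (r n)" for n
  proof (induction n)
    case (Suc n)
    have "(\<lambda>i. d (Suc i + n)) \<in> q_expansions q (r (Suc n))"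
      using Suc r(3) [of n] by (subst (asm) expansion_iff [OF q1]) simp
    moreover have "r n = (d n + r (Suc n)) / q" using r(3) q1 by simp
    ultimately show ?case using Suc by (simp add: prefix_map_append)
  qed (use d r(1) in simp)
  \<comment> \<open>Without a second digit beyond \<open>N\<close> the remainder \<open>r N\<close>
    would have at most one expansion.\<close>
  have "\<exists>m\<ge>N. \<exists>a\<in>{0, 1, q}. a \<noteq> d m \<and> q * r m - a \<in> E_set q"
  proof (rule ccontr)
    assume no: "\<not> ?thesis"
    have "q_expansions q (r N) \<subseteq> {\<lambda>i. d (i + N)}"
    proof
      fix e assume e: "e \<in> q_expansions q (r N)"
      have "(\<lambda>j. e (j + i)) \<in> q_expansions q (r (i + N)) \<and> e i = d (i + N)" for i
      proof (induction i)
        case 0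
        then show ?case using e E_unstep [OF q1 e] no by auto
      next
        case (Suc i)
        then have "(\<lambda>j. e (j + i)) \<in> q_expansions q (r (i + N))" "e i = d (i + N)" by auto
        then have *: "(\<lambda>j. e (j + Suc i)) \<in> q_expansions q (r (Suc i + N))"
          using r(3) [of "i + N"] by (subst (asm) expansion_iff [OF q1]) simp
        then have "e (Suc i) = d (Suc i + N)"
          using E_unstep [OF q1 *] no by (metis add_0 le_add2)
        then show ?case using * by simp
      qed
      then show "e \<in> {\<lambda>i. d (i + N)}" by auto
    qed
    then show False using r(2) finite_subset by blast
  qed
  then obtain m a where m: "N \<le> m" "a \<in> {0, 1, q}" "a \<noteq> d m" "q * r m - a \<in> E_set q" by blast
  have ones: "d (m + k) = 1 \<and> d (Suc (m + k)) = 1 \<and> q * r (Suc (m + k)) - 0 \<in> E_set q" for k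
  proof (induction k)
    case 0
    then show ?case using branch [OF m] by simp
  next
    case (Suc k)
    then show ?case using branch [of "Suc (m + k)" 0] m(1) by auto
  qed
  have "r m = c"
  proof (rule expanding_invariant_trivial [OF q1, of "{r (m + k) | k. True}" "1 + c"])
    show "{r (m + k) | k. True} \<subseteq> {0..1 + c}" by (auto intro!: r_bd [THEN less_imp_le])
    show "r m \<in> {r (m + k) | k. True}" by (metis (mono_tags, lifting) add_0_right mem_Collect_eq)
    fix y assume "y \<in> {r (m + k) | k. True}"
    then obtain k where k: "y = r (m + k)" by blast
    have "c + q * (y - c) = q * y - 1" using c by (simp add: right_diff_distrib)
    also have "\<dots> = r (m + Suc k)" using r(3) [of "m + k"] ones [of k] k by simp
    finally show "c + q * (y - c) \<in> {r (m + k) | k. True}" by blast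
  qed
  moreover have "map d [0..<m] \<in> lists {0, 1, q}"
    using d by (auto simp: q_expansions_def)
  moreover have "x = prefix_map q (map d [0..<m]) (r m)" using shift by blast
  ultimately show ?thesis unfolding c_def by metis
qed

end

lemma U_nat_countable_infinite:
  assumes "q \<in> B_aleph0 - {q_c<..<q_star}"
  shows "countable (U_set q (UNIV :: nat set)) \<and> infinite (U_set q (UNIV :: nat set))"
proof -
  obtain x where q1: "1 < q" and x: "x \<in> U_set q (UNIV :: nat set)"
    using assms by (auto simp: B_aleph0_def U_set_def)
  have not_cont: "\<not> (UNIV :: nat set set) \<lesssim> q_expansions q y" if "y \<in> U_set q (UNIV :: nat set)" for y
    using that continuum_not_countable [OF q1] U_nat_iff by blast
  have "2 \<le> q"
  proof (rule ccontr)
    assume "\<not> 2 \<le> q"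
    moreover have "infinite (q_expansions q x)" using x U_nat_iff by blast
    ultimately show False
      using continuum_small_base [OF q1, of x] infinite_expansions_bounds [OF q1, of x] not_cont [OF x] by simp
  qed
  then have "infinite (U_set q (UNIV :: nat set))" using infinite_U [OF q1] x by blast
  moreover have "countable (U_set q (UNIV :: nat set))"
  proof (cases "q \<le> q_c")
    case True
    have "U_set q (UNIV :: nat set) \<subseteq> {x \<in> E_set q. \<not> (UNIV :: nat set set) \<lesssim> q_expansions q x}"
      using not_cont by (auto simp: U_set_def)
    then show ?thesis
      using countable_U_if_unique_trivial [OF q1] unique_trivial_small_base [OF q1 True] countable_subset
      by meson
  next
    case False
    then have "q_star \<le> q" using assms by auto
    then have "U_set q (UNIV :: nat set) \<subseteq>
        {prefix_map q w y | w y. w \<in> lists {0, 1, q} \<and> y \<in> {1 / (q - 1)}}"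
      using tail_ones_if_few_swap_spots [OF q1] continuum_if_swap_spots [OF q1] not_cont U_nat_iff
      by blast
    then show ?thesis
      by (rule countable_subset) (rule countable_prefix_images, simp)
  qed
  ultimately show ?thesis by blast
qed

section \<open>Hausdorff null sets\<close>

lemma hausdorff_null_iff:
  "hausdorff_measure s A = 0 \<longleftrightarrow>
     (\<forall>\<delta>>0. \<forall>e>0. \<exists>V :: nat \<Rightarrow> 'a::metric_space set. A \<subseteq> (\<Union>i. V i) \<and>
        (\<forall>i. bounded (V i) \<and> diameter (V i) \<le> \<delta>) \<and> (\<Sum>i. hausdorff_weight s (V i)) < e)"
proof -
  have "hausdorff_measure s A = 0 \<longleftrightarrow> (\<forall>\<delta>>0. hausdorff_premeasure s \<delta> A = 0)"
    unfolding hausdorff_measure_def bot_ennreal [symmetric] SUP_bot_conv by auto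
  then show ?thesis
    unfolding hausdorff_premeasure_def bot_ennreal [symmetric] INF_eq_bot_iff by (simp add: conj_assoc)
qed

lemma hausdorff_null_cover:
  fixes A :: "'a::metric_space set"
  assumes "hausdorff_measure s A = 0" "0 < \<delta>" "0 < e"
  obtains V :: "nat \<Rightarrow> 'a set" where "A \<subseteq> (\<Union>i. V i)"
    "\<forall>i. bounded (V i) \<and> diameter (V i) \<le> \<delta>" "(\<Sum>i. hausdorff_weight s (V i)) < e"
proof -
  from hausdorff_null_iff [THEN iffD1, OF assms(1)] assms(2,3)
  obtain V :: "nat \<Rightarrow> 'a set" where "A \<subseteq> (\<Union>i. V i)" "\<forall>i. bounded (V i) \<and> diameter (V i) \<le> \<delta>"
      "(\<Sum>i. hausdorff_weight s (V i)) < e"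
    by metis
  then show thesis by (rule that)
qed

lemma hausdorff_null_subset:
  "hausdorff_measure s B = 0 \<Longrightarrow> A \<subseteq> B \<Longrightarrow> hausdorff_measure s A = 0"
  unfolding hausdorff_null_iff by (meson subset_trans)

lemma hausdorff_null_mono_exponent:
  fixes A :: "'a::metric_space set"
  assumes null: "hausdorff_measure s A = 0" and st: "0 \<le> s" "s \<le> t"
  shows "hausdorff_measure t A = 0"
  unfolding hausdorff_null_iff
proof (intro allI impI)
  fix \<delta> :: real and e :: ennreal assume "0 < \<delta>" "0 < e"
  \<comment> \<open>For diameters at most 1 the weight does not increase with the exponent.\<close>
  then have "0 < min \<delta> 1" by simp
  then obtain V :: "nat \<Rightarrow> 'a set" where V0: "A \<subseteq> (\<Union>i. V i)"
      "\<forall>i. bounded (V i) \<and> diameter (V i) \<le> min \<delta> 1" "(\<Sum>i. hausdorff_weight s (V i)) < e"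
    by (rule hausdorff_null_cover [OF null _ \<open>0 < e\<close>])
  then have V: "A \<subseteq> (\<Union>i. V i)" "bounded (V i)" "diameter (V i) \<le> min \<delta> 1"
      "(\<Sum>i. hausdorff_weight s (V i)) < e" for i
    by blast+
  have "hausdorff_weight t (V i) \<le> hausdorff_weight s (V i)" for i
  proof -
    let ?d = "diameter (V i)"
    have d: "0 \<le> ?d" "?d \<le> 1" using V(3) [of i] diameter_ge_0 [OF V(2)] by auto
    have "?d powr t \<le> 1" if "0 < t" using d that by (simp add: powr_le1)
    moreover have "?d powr t \<le> ?d powr s" if "0 < s"
      using d st that by (cases "?d = 0") (auto intro: powr_mono')
    ultimately show ?thesis using st by (auto simp: hausdorff_weight_def ennreal_leI)
  qed
  then have "(\<Sum>i. hausdorff_weight t (V i)) \<le> (\<Sum>i. hausdorff_weight s (V i))"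
    by (intro suminf_le) auto
  then show "\<exists>V. A \<subseteq> (\<Union>i. V i) \<and> (\<forall>i. bounded (V i) \<and> diameter (V i) \<le> \<delta>) \<and>
      (\<Sum>i. hausdorff_weight t (V i)) < e"
    using V by (intro exI [of _ V]) auto
qed

lemma hausdorff_null_UN:
  fixes A :: "nat \<Rightarrow> 'a::metric_space set"
  assumes null: "\<And>n. hausdorff_measure s (A n) = 0"
  shows "hausdorff_measure s (\<Union>n. A n) = 0"
  unfolding hausdorff_null_iff
proof (intro allI impI)
  fix \<delta> :: real and e :: ennreal assume "0 < \<delta>" "0 < e"
  obtain e' where "0 < e'" "e' < e" using dense [OF \<open>0 < e\<close>] by blast
  then obtain r where r: "0 < r" "ennreal r < e"
    by (cases e') auto
  have "\<exists>V :: nat \<Rightarrow> 'a set. A n \<subseteq> (\<Union>i. V i) \<and> (\<forall>i. bounded (V i) \<and> diameter (V i) \<le> \<delta>) \<and>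
      (\<Sum>i. hausdorff_weight s (V i)) < ennreal (r * (1 / 2) ^ Suc n)" for n
    using null [of n] r(1) \<open>0 < \<delta>\<close> unfolding hausdorff_null_iff by simp
  then obtain V :: "nat \<Rightarrow> nat \<Rightarrow> 'a set" where V: "\<And>n. A n \<subseteq> (\<Union>i. V n i)"
      "\<And>n i. bounded (V n i) \<and> diameter (V n i) \<le> \<delta>"
      "\<And>n. (\<Sum>i. hausdorff_weight s (V n i)) < ennreal (r * (1 / 2) ^ Suc n)"
    by metis
  define W where "W k = (case prod_decode k of (n, i) \<Rightarrow> V n i)" for k
  have "(\<Sum>k. hausdorff_weight s (W k)) = (\<Sum>n. \<Sum>i. hausdorff_weight s (V n i))"
    unfolding W_def
    using suminf_ennreal_2dimen [of "\<lambda>n. \<Sum>i. hausdorff_weight s (V n i)"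
        "\<lambda>(n, i). hausdorff_weight s (V n i)"]
    by (simp add: case_prod_beta)
  also have "\<dots> \<le> (\<Sum>n. ennreal (r * (1 / 2) ^ Suc n))"
    using V(3) by (intro suminf_le) (auto intro: less_imp_le)
  also have "\<dots> = ennreal r"
  proof (rule suminf_ennreal_eq)
    show "(\<lambda>n. r * (1 / 2) ^ Suc n) sums r"
      using sums_mult [OF power_half_series, of r] by simp
  qed (use r in simp)
  also have "\<dots> < e" by (rule r)
  finally have "(\<Sum>k. hausdorff_weight s (W k)) < e" .
  moreover have "(\<Union>n. A n) \<subseteq> (\<Union>k. W k)"
  proof
    fix x assume "x \<in> (\<Union>n. A n)"
    then obtain n i where "x \<in> V n i" using V(1) by blast
    then have "x \<in> W (prod_encode (n, i))" by (simp add: W_def)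
    then show "x \<in> (\<Union>k. W k)" by blast
  qed
  moreover have "bounded (W k) \<and> diameter (W k) \<le> \<delta>" for k
    using V(2) by (simp add: W_def case_prod_beta)
  ultimately show "\<exists>V. (\<Union>n. A n) \<subseteq> (\<Union>i. V i) \<and> (\<forall>i. bounded (V i) \<and> diameter (V i) \<le> \<delta>) \<and>
      (\<Sum>i. hausdorff_weight s (V i)) < e"
    by blast
qed

lemma hausdorff_null_countable_Union:
  fixes \<A> :: "'a::metric_space set set"
  assumes "countable \<A>" "\<And>A. A \<in> \<A> \<Longrightarrow> hausdorff_measure s A = 0"
  shows "hausdorff_measure s (\<Union>\<A>) = 0"
proof (cases "\<A> = {}")
  case True
  have "\<exists>V. {} \<subseteq> (\<Union>i::nat. V i :: 'a set) \<and> (\<forall>i. bounded (V i) \<and> diameter (V i) \<le> \<delta>) \<and>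
      (\<Sum>i. hausdorff_weight s (V i)) < e" if "0 < \<delta>" "0 < e" for \<delta> e
    using that by (intro exI [of _ "\<lambda>_. {}"]) (simp add: hausdorff_weight_def)
  then show ?thesis using True unfolding hausdorff_null_iff by simp
next
  case False
  then have "hausdorff_measure s (\<Union>n. from_nat_into \<A> n) = 0"
    using assms(2) by (intro hausdorff_null_UN) (simp add: from_nat_into)
  then show ?thesis using False assms(1) by simp
qed

text \<open>The \<open>n\<close>-th cover has total weight at most
  \<open>K * L powr s * (\<beta> * \<rho> powr s) ^ n\<close>, which tends to 0.\<close>

lemma hausdorff_null_if_finite_covers:
  fixes A :: "'a::metric_space set"
  assumes s: "0 < s"
    and cov: "\<And>n. \<exists>C. finite C \<and> real (card C) \<le> K * \<beta> ^ n \<and> A \<subseteq> \<Union>C \<and>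
        (\<forall>V\<in>C. bounded V \<and> diameter V \<le> L * \<rho> ^ n)"
    and L: "0 < L" and \<rho>: "0 < \<rho>" "\<rho> < 1" and small: "0 \<le> \<beta>" "\<beta> * \<rho> powr s < 1"
  shows "hausdorff_measure s A = 0"
  unfolding hausdorff_null_iff
proof (intro allI impI)
  fix \<delta> :: real and e :: ennreal assume \<delta>: "0 < \<delta>" and e: "0 < e"
  obtain e' where "0 < e'" "e' < e" using dense [OF e] by blast
  then obtain r where r: "0 < r" "ennreal r < e"
    by (cases e') auto
  have "(\<lambda>n. K * L powr s * (\<beta> * \<rho> powr s) ^ n) \<longlonglongrightarrow> K * L powr s * 0"
    using small by (intro tendsto_mult tendsto_const LIMSEQ_power_zero) simp
  then have "\<forall>\<^sub>F n in sequentially. K * L powr s * (\<beta> * \<rho> powr s) ^ n < r"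
    using r(1) by (auto dest: order_tendstoD(2))
  moreover have "(\<lambda>n. L * \<rho> ^ n) \<longlonglongrightarrow> L * 0"
    using \<rho> by (intro tendsto_mult tendsto_const LIMSEQ_power_zero) simp
  then have "\<forall>\<^sub>F n in sequentially. L * \<rho> ^ n < \<delta>"
    using \<delta> by (auto dest: order_tendstoD(2))
  ultimately have "\<forall>\<^sub>F n in sequentially. K * L powr s * (\<beta> * \<rho> powr s) ^ n < r \<and> L * \<rho> ^ n < \<delta>"
    by (rule eventually_conj)
  then obtain n where n: "K * L powr s * (\<beta> * \<rho> powr s) ^ n < r" "L * \<rho> ^ n < \<delta>"
    by (auto simp: eventually_sequentially)
  obtain C where C: "finite C" "real (card C) \<le> K * \<beta> ^ n" "A \<subseteq> \<Union>C"
      "\<And>V. V \<in> C \<Longrightarrow> bounded V \<and> diameter V \<le> L * \<rho> ^ n"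
    using cov [of n] by blast
  obtain h where h: "bij_betw h {..<card C} C"
    using ex_bij_betw_nat_finite [OF C(1)] by (auto simp: atLeast0LessThan)
  \<comment> \<open>Padding by the empty set, of weight 0, turns the finite cover into a
    sequence.\<close>
  define V where "V i = (if i < card C then h i else {})" for i
  have VC: "i < card C \<Longrightarrow> V i \<in> C" for i
    using h by (auto simp: V_def bij_betw_def)
  have "A \<subseteq> (\<Union>i. V i)"
  proof
    fix x assume "x \<in> A"
    then obtain W where W: "W \<in> C" "x \<in> W" using C(3) by blast
    have "W \<in> h ` {..<card C}" using W(1) h by (simp add: bij_betw_def)
    then obtain i where "i < card C" "h i = W" by auto
    then have "x \<in> V i" using W by (simp add: V_def)
    then show "x \<in> (\<Union>i. V i)" by blast
  qed
  moreover have "bounded (V i) \<and> diameter (V i) \<le> \<delta>" for i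
  proof (cases "i < card C")
    case True
    then show ?thesis using C(4) [OF VC] n(2) by fastforce
  next
    case False
    then show ?thesis using \<delta> by (simp add: V_def)
  qed
  moreover have "(\<Sum>i. hausdorff_weight s (V i)) < e"
  proof -
    have "(\<Sum>i. hausdorff_weight s (V i)) = (\<Sum>i<card C. hausdorff_weight s (V i))"
      by (rule suminf_finite) (auto simp: V_def hausdorff_weight_def)
    also have "\<dots> \<le> (\<Sum>i<card C. ennreal (L powr s * (\<rho> powr s) ^ n))"
    proof (rule sum_mono)
      fix i assume "i \<in> {..<card C}"
      then have V: "bounded (V i)" "diameter (V i) \<le> L * \<rho> ^ n" using C(4) [OF VC] by auto
      have "diameter (V i) powr s \<le> (L * \<rho> ^ n) powr s"
        using s V diameter_ge_0 by (intro powr_mono2) auto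
      also have "\<dots> = L powr s * (\<rho> powr s) ^ n"
        using L \<rho> by (simp add: powr_mult powr_power mult.commute powr_realpow [symmetric] powr_powr)
      finally show "hausdorff_weight s (V i) \<le> ennreal (L powr s * (\<rho> powr s) ^ n)"
        using s by (auto simp: hausdorff_weight_def ennreal_leI)
    qed
    also have "\<dots> = ennreal (real (card C) * (L powr s * (\<rho> powr s) ^ n))"
      by (simp add: ennreal_mult ennreal_of_nat_eq_real_of_nat)
    also have "\<dots> \<le> ennreal (K * \<beta> ^ n * (L powr s * (\<rho> powr s) ^ n))"
      using C(2) by (intro ennreal_leI mult_right_mono) auto
    also have "K * \<beta> ^ n * (L powr s * (\<rho> powr s) ^ n) = K * L powr s * (\<beta> * \<rho> powr s) ^ n"
      by (simp add: power_mult_distrib)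
    also have "ennreal \<dots> \<le> ennreal r" using n(1) by (intro ennreal_leI) simp
    finally show ?thesis using r(2) by simp
  qed
  ultimately show "\<exists>V. A \<subseteq> (\<Union>i. V i) \<and> (\<forall>i. bounded (V i) \<and> diameter (V i) \<le> \<delta>) \<and>
      (\<Sum>i. hausdorff_weight s (V i)) < e"
    by blast
qed

lemma hausdorff_null_countable:
  fixes A :: "'a::metric_space set"
  assumes "0 < s" "countable A"
  shows "hausdorff_measure s A = 0"
proof -
  have "hausdorff_measure s {x} = 0" for x :: 'a
  proof (rule hausdorff_null_if_finite_covers [OF assms(1), where K = 1 and \<beta> = 1 and L = 1 and \<rho> = "1/2"])
    show "\<exists>C. finite C \<and> real (card C) \<le> 1 * 1 ^ n \<and> {x} \<subseteq> \<Union>C \<and>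
        (\<forall>V\<in>C. bounded V \<and> diameter V \<le> 1 * (1 / 2) ^ n)" for n
      by (intro exI [of _ "{{x}}"]) simp
    have "1 < (2::real) powr s" using assms(1) by (simp add: gr_one_powr)
    then show "1 * (1 / 2) powr s < (1::real)" by (simp add: powr_divide)
  qed simp_all
  then have "hausdorff_measure s (\<Union>((\<lambda>x. {x}) ` A)) = 0"
    using assms(2) by (intro hausdorff_null_countable_Union) auto
  then show ?thesis by simp
qed

text \<open>A cover of \<open>A\<close> is transported by \<open>R\<close> to a cover of
  \<open>{0..m}\<close> by intervals of length \<open>2 * C * diameter (V i) powr s\<close>, so
  Lebesgue measure bounds \<open>m\<close> by \<open>2 * C\<close> times the weight of the cover.
  \<open>R\<close> is a relation because its pairs will be parametrised by digit codes.\<close>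

lemma hausdorff_not_null_if_Hoelder:
  fixes A :: "'a::metric_space set" and R :: "('a \<times> real) set"
  assumes s: "0 < s" and C: "0 \<le> C" and m: "0 < m"
    and H: "\<And>x y x' y'. (x, y) \<in> R \<Longrightarrow> (x', y') \<in> R \<Longrightarrow> \<bar>y - y'\<bar> \<le> C * dist x x' powr s"
    and dom: "Domain R \<subseteq> A" and ran: "{0..m} \<subseteq> Range R"
  shows "hausdorff_measure s A \<noteq> 0"
proof
  assume null: "hausdorff_measure s A = 0"
  \<comment> \<open>The bound is chosen so that \<open>2 * C * (m / (2 * C + 1)) < m\<close>; the
    summand 1 keeps the denominator positive when \<open>C = 0\<close>.\<close>
  have pos: "0 < ennreal (m / (2 * C + 1))" using m C by simp
  obtain V :: "nat \<Rightarrow> 'a set" where V: "A \<subseteq> (\<Union>i. V i)" "\<forall>i. bounded (V i) \<and> diameter (V i) \<le> 1"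
      "(\<Sum>i. hausdorff_weight s (V i)) < ennreal (m / (2 * C + 1))"
    by (rule hausdorff_null_cover [OF null zero_less_one pos])
  have bdV: "bounded (V i)" for i using V(2) by blast
  define y where "y i = (SOME y. y \<in> R `` V i)" for i
  \<comment> \<open>An interval around one chosen image point contains the whole image of
    \<open>V i\<close> and is measurable.\<close>
  define J where "J i = (if R `` V i = {} then {} else
      {y i - C * diameter (V i) powr s .. y i + C * diameter (V i) powr s})" for i
  have WJ: "R `` V i \<subseteq> J i" for i
  proof
    fix z assume z: "z \<in> R `` V i"
    then have "y i \<in> R `` V i" unfolding y_def by (rule someI)
    then obtain a b where ab: "a \<in> V i" "b \<in> V i" "(a, y i) \<in> R" "(b, z) \<in> R" using z by blast
    have "\<bar>y i - z\<bar> \<le> C * dist a b powr s" using H ab by blast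
    also have "\<dots> \<le> C * diameter (V i) powr s"
      using C s diameter_bounded_bound [OF bdV ab(1,2)] by (intro mult_left_mono powr_mono2) auto
    finally show "z \<in> J i" using z by (auto simp: J_def)
  qed
  have "{0..m} \<subseteq> (\<Union>i. J i)"
  proof
    fix z assume "z \<in> {0..m}"
    then obtain x where "(x, z) \<in> R" using ran by blast
    moreover from this obtain i where "x \<in> V i" using dom V(1) by blast
    ultimately show "z \<in> (\<Union>i. J i)" using WJ by blast
  qed
  then have "emeasure lborel {0..m} \<le> emeasure lborel (\<Union>i. J i)"
    by (rule emeasure_mono) (auto simp: J_def)
  also have "\<dots> \<le> (\<Sum>i. emeasure lborel (J i))"
    by (rule emeasure_subadditive_countably) (auto simp: J_def)
  also have "\<dots> \<le> (\<Sum>i. ennreal (2 * C) * hausdorff_weight s (V i))"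
  proof (rule suminf_le)
    fix i
    show "emeasure lborel (J i) \<le> ennreal (2 * C) * hausdorff_weight s (V i)"
      using C s by (auto simp: J_def hausdorff_weight_def ennreal_mult' [symmetric] intro!: ennreal_leI)
  qed auto
  also have "\<dots> = ennreal (2 * C) * (\<Sum>i. hausdorff_weight s (V i))"
    by (rule ennreal_suminf_cmult)
  also have "\<dots> \<le> ennreal (2 * C) * ennreal (m / (2 * C + 1))"
    using V(3) by (intro mult_left_mono) auto
  also have "\<dots> = ennreal (2 * C * (m / (2 * C + 1)))"
    using C m by (intro ennreal_mult [symmetric]) auto
  also have "\<dots> < ennreal m"
    using C m by (intro ennreal_lessI) (auto simp: field_simps)
  finally show False using m by simp
qed

text \<open>If \<open>U\<close> is null for \<open>s\<close>, then \<open>s0 < s\<close>, since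
  otherwise \<open>U\<close> and \<open>N\<close>, and with them \<open>E\<close>, would be null for
  \<open>s0\<close>. For such \<open>s\<close> the set \<open>N\<close> is null as well, so
  \<open>U\<close> and \<open>E\<close> have the same null exponents.\<close>

lemma hausdorff_dim_remove_small:
  fixes E :: "'a::metric_space set"
  assumes E: "E = U \<union> N" and t: "0 \<le> t" "t < s0"
    and N: "\<And>s. t < s \<Longrightarrow> hausdorff_measure s N = 0"
    and s0: "hausdorff_measure s0 E \<noteq> 0"
  shows "hausdorff_dim U = hausdorff_dim E"
proof -
  have "hausdorff_measure s E = 0" if s: "0 \<le> s" "hausdorff_measure s U = 0" for s
  proof -
    have *: "hausdorff_measure s' E = 0" if "hausdorff_measure s' U = 0" "t < s'" for s'
      using hausdorff_null_countable_Union [of "{U, N}" s'] that N E by auto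
    have "t < s"
      using * [OF hausdorff_null_mono_exponent [OF s(2,1), of s0] t(2)] s0 t(2) by linarith
    then show ?thesis using * s by blast
  qed
  then have "{s. 0 \<le> s \<and> hausdorff_measure s U = 0} = {s. 0 \<le> s \<and> hausdorff_measure s E = 0}"
    using hausdorff_null_subset E by (metis sup_ge1)
  then show ?thesis by (simp add: hausdorff_dim_def)
qed

section \<open>Points without continuum many expansions\<close>

definition finitely_covered :: "real \<Rightarrow> real \<Rightarrow> real set \<Rightarrow> bool" where
  "finitely_covered K \<delta> A \<longleftrightarrow> (\<exists>C. finite C \<and> real (card C) \<le> K \<and> A \<subseteq> \<Union>C \<and>
     (\<forall>V\<in>C. bounded V \<and> diameter V \<le> \<delta>))"

lemma finitely_covered_Un:
  assumes "finitely_covered K \<delta> A" "finitely_covered L \<delta> B"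
  shows "finitely_covered (K + L) \<delta> (A \<union> B)"
proof -
  obtain C D where C: "finite C" "real (card C) \<le> K" "A \<subseteq> \<Union>C" "\<forall>V\<in>C. bounded V \<and> diameter V \<le> \<delta>"
    and D: "finite D" "real (card D) \<le> L" "B \<subseteq> \<Union>D" "\<forall>V\<in>D. bounded V \<and> diameter V \<le> \<delta>"
    using assms unfolding finitely_covered_def by metis
  have "real (card (C \<union> D)) \<le> K + L"
    using card_Un_le [of C D] C(2) D(2) by linarith
  then show ?thesis unfolding finitely_covered_def
    using C D by (intro exI [of _ "C \<union> D"]) auto
qed

lemma finitely_covered_mono:
  "finitely_covered K \<delta> A \<Longrightarrow> B \<subseteq> A \<Longrightarrow> K \<le> L \<Longrightarrow> \<delta> \<le> \<epsilon> \<Longrightarrow> finitely_covered L \<epsilon> B"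
  unfolding finitely_covered_def by (meson order_trans)

lemma finitely_covered_affine:
  assumes "finitely_covered K \<delta> A" "0 < q" "0 \<le> \<delta>"
  shows "finitely_covered K (\<delta> / q) ((\<lambda>y. (a + y) / q) ` A)"
proof -
  let ?f = "\<lambda>y. (a + y) / q"
  obtain C where C: "finite C" "real (card C) \<le> K" "A \<subseteq> \<Union>C" "\<forall>V\<in>C. bounded V \<and> diameter V \<le> \<delta>"
    using assms(1) unfolding finitely_covered_def by metis
  have "bounded (?f ` V) \<and> diameter (?f ` V) \<le> \<delta> / q" if V: "V \<in> C" for V
  proof -
    have d: "dist (?f x) (?f y) \<le> \<delta> / q" if "x \<in> V" "y \<in> V" for x y
    proof -
      have "dist x y \<le> \<delta>" using diameter_bounded_bound [of V x y] C(4) V that by fastforce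
      moreover have "?f x - ?f y = (x - y) / q" by (simp add: diff_divide_distrib add_divide_distrib)
      ultimately show ?thesis using assms(2) by (simp add: dist_real_def divide_right_mono)
    qed
    have "bounded (?f ` V)"
      unfolding bounded_two_points using d by blast
    moreover have "diameter (?f ` V) \<le> \<delta> / q"
      using d assms by (intro diameter_le) (auto simp: dist_norm)
    ultimately show ?thesis by blast
  qed
  moreover have "real (card ((`) ?f ` C)) \<le> K"
    using card_image_le [OF C(1), of "(`) ?f"] C(2) by linarith
  moreover have "?f ` A \<subseteq> \<Union>((`) ?f ` C)" using C(3) by blast
  ultimately show ?thesis
    unfolding finitely_covered_def using C(1) by (intro exI [of _ "(`) ?f ` C"]) auto
qed

lemma finitely_covered_prefix_map:
  assumes "finitely_covered K \<delta> A" "1 < q" "0 \<le> \<delta>"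
  shows "finitely_covered K \<delta> (prefix_map q w ` A)"
proof (induction w)
  case (Cons a w)
  have "finitely_covered K (\<delta> / q) ((\<lambda>y. (a + y) / q) ` prefix_map q w ` A)"
    using Cons assms by (intro finitely_covered_affine) auto
  moreover have "\<delta> / q \<le> \<delta>" using assms(2,3) by (simp add: field_simps mult_le_cancel_left1)
  moreover have "prefix_map q (a # w) ` A = (\<lambda>y. (a + y) / q) ` prefix_map q w ` A"
    by (simp add: image_image)
  ultimately show ?case
    using finitely_covered_mono by (metis order_refl)
qed (use assms in simp)

text \<open>The first digit \<open>a\<close> is the state in a transition graph that lacks the edges
  from 0 to \<open>q\<close> and from 1 to 0.\<close>

definition no_swap_points :: "real \<Rightarrow> real \<Rightarrow> real set" where
  "no_swap_points q a = {y. \<exists>d \<in> q_expansions q y. d 0 = a \<and> (\<forall>i. \<not> swap_spot q d i)}"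

context
  fixes q :: real
  assumes q1: "1 < q"
begin

lemma no_swap_points_step:
  assumes "y \<in> no_swap_points q a"
  shows "\<exists>b\<in>{0, 1, q}. \<not> (a = 0 \<and> b = q) \<and> \<not> (a = 1 \<and> b = 0) \<and>
    y \<in> (\<lambda>z. (a + z) / q) ` no_swap_points q b"
proof -
  obtain d where d: "d \<in> q_expansions q y" "d 0 = a" "\<And>i. \<not> swap_spot q d i"
    using assms by (auto simp: no_swap_points_def)
  have "(\<lambda>i. d (Suc i)) \<in> q_expansions q (q * y - a)" "d (Suc 0) \<in> {0, 1, q}"
    using d(1) iffD1 [OF expansion_iff [OF q1] d(1)] d(2) by (auto simp: q_expansions_def)
  moreover have "\<not> swap_spot q (\<lambda>i. d (Suc i)) i" for i
    using d(3) [of "Suc i"] by (simp add: swap_spot_def)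
  ultimately have "q * y - a \<in> no_swap_points q (d (Suc 0))"
    unfolding no_swap_points_def by (intro CollectI bexI [where x = "\<lambda>i. d (Suc i)"]) auto
  moreover have "y = (a + (q * y - a)) / q" using q1 by simp
  ultimately have "y \<in> (\<lambda>z. (a + z) / q) ` no_swap_points q (d (Suc 0))" by blast
  then show ?thesis
    using d(2) d(3) [of 0] \<open>d (Suc 0) \<in> {0, 1, q}\<close> by (intro bexI [of _ "d (Suc 0)"]) (auto simp: swap_spot_def)
qed

text \<open>The transfer matrix of the admissible pairs of digits has the eigenvector \<open>(1, u, u\<^sup>2)\<close>
  with eigenvalue \<open>q_c\<close>, where \<open>u = q_c - 1\<close> satisfies \<open>u\<^sup>3 = u + 1\<close>.\<close>

lemma no_swap_points_covered:
  defines "u \<equiv> q_c - 1" and "M \<equiv> q / (q - 1)"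
  shows "finitely_covered (q_c ^ n) (M * (1 / q) ^ n) (no_swap_points q 0) \<and>
    finitely_covered (u * q_c ^ n) (M * (1 / q) ^ n) (no_swap_points q 1) \<and>
    finitely_covered (u\<^sup>2 * q_c ^ n) (M * (1 / q) ^ n) (no_swap_points q q)"
proof (induction n)
  case 0
  have "1 \<le> u" using q_c_bounds unfolding u_def by simp
  then have "1 \<le> u\<^sup>2" by simp
  have "0 \<le> M" using q1 unfolding M_def by simp
  have "finitely_covered 1 M {0..M}"
    unfolding finitely_covered_def using \<open>0 \<le> M\<close> by (intro exI [of _ "{{0..M}}"]) simp
  moreover have "no_swap_points q a \<subseteq> {0..M}" for a
    using expansion_bounds [OF q1] by (auto simp: no_swap_points_def M_def)
  ultimately have "finitely_covered K M (no_swap_points q a)" if "1 \<le> K" for K a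
    using that by (rule finitely_covered_mono) simp
  then show ?case using \<open>1 \<le> u\<close> \<open>1 \<le> u\<^sup>2\<close> by simp
next
  case (Suc n)
  let ?X = "no_swap_points q" and ?\<delta> = "M * (1 / q) ^ n"
  let ?f = "\<lambda>a z. (a + z) / q"
  have M: "0 \<le> ?\<delta>" using q1 unfolding M_def by simp
  have \<delta>: "?\<delta> / q = M * (1 / q) ^ Suc n" by simp
  have aff: "finitely_covered L (M * (1 / q) ^ Suc n) (?X a)"
    if "finitely_covered K ?\<delta> B" "?X a \<subseteq> ?f a ` B" "K \<le> L" for K L B a
  proof (rule finitely_covered_mono [OF _ that(2,3) order_refl])
    show "finitely_covered K (M * (1 / q) ^ Suc n) (?f a ` B)"
      unfolding \<delta> [symmetric] by (rule finitely_covered_affine [OF that(1) _ M]) (use q1 in simp)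
  qed
  have 0: "?X 0 \<subseteq> ?f 0 ` (?X 0 \<union> ?X 1)" and 1: "?X 1 \<subseteq> ?f 1 ` (?X 1 \<union> ?X q)"
    and 2: "?X q \<subseteq> ?f q ` (?X 0 \<union> (?X 1 \<union> ?X q))"
    using no_swap_points_step by (blast, blast, blast)
  have u: "q_c = 1 + u" "u ^ 3 = 1 + u"
    using q_c_root unfolding u_def by (auto simp: algebra_simps power2_eq_square power3_eq_cube)
  have "finitely_covered (q_c ^ Suc n) (M * (1 / q) ^ Suc n) (?X 0)"
    by (rule aff [OF finitely_covered_Un [OF conjunct1 [OF Suc] conjunct1 [OF conjunct2 [OF Suc]]] 0])
      (simp add: u(1) algebra_simps)
  moreover have "finitely_covered (u * q_c ^ Suc n) (M * (1 / q) ^ Suc n) (?X 1)"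
    by (rule aff [OF finitely_covered_Un [OF conjunct1 [OF conjunct2 [OF Suc]] conjunct2 [OF conjunct2 [OF Suc]]] 1])
      (simp add: u(1) algebra_simps power2_eq_square)
  \<comment> \<open>The eigenvector equation for the state \<open>q\<close>:
    \<open>1 + u + u\<^sup>2 = u ^ 3 + u\<^sup>2 = u\<^sup>2 * q_c\<close>.\<close>
  moreover have "q_c ^ n + (u * q_c ^ n + u\<^sup>2 * q_c ^ n) = u\<^sup>2 * q_c ^ Suc n"
  proof -
    have "1 + u + u\<^sup>2 = u\<^sup>2 * q_c" using u(2) by (simp add: u(1) algebra_simps power2_eq_square power3_eq_cube)
    then have "(1 + u + u\<^sup>2) * q_c ^ n = u\<^sup>2 * q_c * q_c ^ n" by simp
    then show ?thesis by (simp add: algebra_simps)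
  qed
  then have "finitely_covered (u\<^sup>2 * q_c ^ Suc n) (M * (1 / q) ^ Suc n) (?X q)"
    by (intro aff [OF finitely_covered_Un [OF conjunct1 [OF Suc]
      finitely_covered_Un [OF conjunct1 [OF conjunct2 [OF Suc]] conjunct2 [OF conjunct2 [OF Suc]]]] 2]) simp
  ultimately show ?case by blast
qed

text \<open>An expansion of such a point has only finitely many swap spots, and behind the last one
  the tail lies in some \<open>no_swap_points q a\<close>. Hence the set is contained in a countable
  union of prefix images of these sets, each covered for every \<open>n\<close> by at most a
  multiple of \<open>q_c ^ n\<close> sets of size of order \<open>1 / q ^ n\<close>.\<close>

lemma non_continuum_null:
  assumes "log q q_c < s"
  shows "hausdorff_measure s {x \<in> E_set q. \<not> (UNIV :: nat set set) \<lesssim> q_expansions q x} = 0"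
proof -
  have qc: "1 < q_c" using q_c_bounds by simp
  then have s: "0 < s" using assms q1 zero_less_log_cancel_iff [of q q_c] by linarith
  have small: "q_c * (1 / q) powr s < 1"
  proof -
    have "q_c = q powr (log q q_c)" using q1 qc by simp
    also have "\<dots> < q powr s" using assms q1 by simp
    finally show ?thesis using q1 by (simp add: powr_divide)
  qed
  have null: "hausdorff_measure s (prefix_map q w ` no_swap_points q a) = 0" if "a \<in> {0, 1, q}" for w a
  proof (rule hausdorff_null_if_finite_covers [OF s, where \<beta> = q_c and \<rho> = "1 / q"
        and K = "(q_c - 1)\<^sup>2" and L = "q / (q - 1)"])
    fix n
    let ?u = "q_c - 1"
    have "1 \<le> ?u" using q_c_bounds by simp
    \<comment> \<open>The square dominates all three eigenvector entries, so one constant serves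
      every state.\<close>
    then have "1 * ?u \<le> ?u * ?u" "1 * 1 \<le> ?u * ?u" by (intro mult_mono; simp)+
    then have u: "1 \<le> ?u\<^sup>2" "?u \<le> ?u\<^sup>2" by (simp_all add: power2_eq_square)
    have "q_c ^ n \<le> ?u\<^sup>2 * q_c ^ n" "?u * q_c ^ n \<le> ?u\<^sup>2 * q_c ^ n"
      using mult_right_mono [OF u(1), of "q_c ^ n"] mult_right_mono [OF u(2), of "q_c ^ n"] qc by auto
    then have "finitely_covered (?u\<^sup>2 * q_c ^ n) (q / (q - 1) * (1 / q) ^ n) (no_swap_points q a)"
      using that no_swap_points_covered [of n] finitely_covered_mono [OF _ order_refl _ order_refl] by blast
    then have "finitely_covered (?u\<^sup>2 * q_c ^ n) (q / (q - 1) * (1 / q) ^ n) (prefix_map q w ` no_swap_points q a)"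
      using q1 by (intro finitely_covered_prefix_map) auto
    then show "\<exists>C. finite C \<and> real (card C) \<le> ?u\<^sup>2 * q_c ^ n \<and> prefix_map q w ` no_swap_points q a \<subseteq> \<Union>C \<and>
        (\<forall>V\<in>C. bounded V \<and> diameter V \<le> q / (q - 1) * (1 / q) ^ n)"
      by (simp add: finitely_covered_def)
  qed (use q1 qc small in auto)
  let ?\<A> = "(\<lambda>(w, a). prefix_map q w ` no_swap_points q a) ` (lists {0, 1, q} \<times> {0, 1, q})"
  have "hausdorff_measure s (\<Union>?\<A>) = 0"
  proof (rule hausdorff_null_countable_Union)
    show "countable ?\<A>" by simp
  qed (use null in auto)
  moreover have "{x \<in> E_set q. \<not> (UNIV :: nat set set) \<lesssim> q_expansions q x} \<subseteq> \<Union>?\<A>"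
  proof
    fix x assume "x \<in> {x \<in> E_set q. \<not> (UNIV :: nat set set) \<lesssim> q_expansions q x}"
    then obtain d where d: "d \<in> q_expansions q x" "finite {i. swap_spot q d i}"
      using continuum_if_swap_spots [OF q1] by (auto simp: E_set_def)
    then obtain n where n: "\<And>i. n \<le> i \<Longrightarrow> \<not> swap_spot q d i"
      unfolding finite_nat_set_iff_bounded by (metis mem_Collect_eq not_le)
    obtain y where y: "x = prefix_map q (map d [0..<n]) y" "(\<lambda>i. d (i + n)) \<in> q_expansions q y"
      using expansion_shift [OF q1 d(1)] by blast
    have "\<not> swap_spot q (\<lambda>i. d (i + n)) i" for i using n unfolding swap_spot_shift by simp
    then have "y \<in> no_swap_points q (d n)"
      using y(2) unfolding no_swap_points_def by (intro CollectI bexI [OF _ y(2)]) simp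
    then have "x \<in> prefix_map q (map d [0..<n]) ` no_swap_points q (d n)" using y(1) by blast
    moreover have "map d [0..<n] \<in> lists {0, 1, q}" "d n \<in> {0, 1, q}"
      using d(1) by (auto simp: q_expansions_def)
    ultimately show "x \<in> \<Union>?\<A>" by blast
  qed
  ultimately show ?thesis using hausdorff_null_subset by blast
qed

lemma E_not_null_if_interval:
  assumes "q \<le> q_star"
  shows "hausdorff_measure 1 (E_set q) \<noteq> 0"
proof (rule hausdorff_not_null_if_Hoelder [where C = 1 and m = "q / (q - 1)" and R = "Id_on {0..q / (q - 1)}"])
  show "Domain (Id_on {0..q / (q - 1)}) \<subseteq> E_set q" using E_eq_interval [OF q1 assms] by simp
  show "0 < q / (q - 1)" using q1 by simp
qed (auto simp: dist_real_def)

end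

section \<open>Change of base\<close>

text \<open>Letters 0, 1, 2 stand for the digits 0, 1, \<open>b\<close>, so that one code can be
  evaluated in several bases.\<close>

definition digit :: "real \<Rightarrow> nat \<Rightarrow> real" where
  "digit b k = (if k = 0 then 0 else if k = 1 then 1 else b)"

definition code_val :: "real \<Rightarrow> (nat \<Rightarrow> nat) \<Rightarrow> real" where
  "code_val b c = (\<Sum>i. digit b (c i) / b ^ Suc i)"

text \<open>Of the two words of equal value, \<open>02\<close> is kept and \<open>10\<close> is
  excluded.\<close>

definition admissible :: "(nat \<Rightarrow> nat) \<Rightarrow> bool" where
  "admissible c \<longleftrightarrow> (\<forall>i. c i \<le> 2 \<and> \<not> (c i = 1 \<and> c (Suc i) = 0))"

lemma digit_simps [simp]: "digit b 0 = 0" "digit b (Suc 0) = 1" "digit b 2 = b"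
  by (simp_all add: digit_def)

lemma admissible_Suc: "admissible c \<Longrightarrow> admissible (\<lambda>i. c (Suc i))"
  by (simp add: admissible_def)

context
  fixes b :: real
  assumes b1: "1 < b"
begin

lemma code_expansion: "(\<lambda>i. digit b (c i)) \<in> q_expansions b (code_val b c)"
proof -
  have "digit b (c i) \<in> {0, 1, b}" for i by (simp add: digit_def)
  then obtain x where "(\<lambda>i. digit b (c i)) \<in> q_expansions b x"
    using expansions_exist [OF b1, of "\<lambda>i. digit b (c i)"] by blast
  moreover from this have "x = code_val b c"
    unfolding code_val_def q_expansions_def by (simp add: sums_iff)
  ultimately show ?thesis by simp
qed

lemma code_val_eqI: "(\<lambda>i. digit b (c i)) \<in> q_expansions b x \<Longrightarrow> code_val b c = x"
  unfolding code_val_def q_expansions_def by (simp add: sums_iff)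

lemma code_val_step: "code_val b c = (digit b (c 0) + code_val b (\<lambda>i. c (Suc i))) / b"
proof -
  have "(\<lambda>i. digit b (c (Suc i))) \<in> q_expansions b (b * code_val b c - digit b (c 0))"
    using iffD1 [OF expansion_iff [OF b1] code_expansion [of c]] by simp
  then have "code_val b (\<lambda>i. c (Suc i)) = b * code_val b c - digit b (c 0)"
    by (rule code_val_eqI)
  then show ?thesis using b1 by simp
qed

lemma code_val_bounds: "0 \<le> code_val b c" "code_val b c \<le> b / (b - 1)"
  using expansion_bounds [OF b1 code_expansion [of c]] by auto

lemma code_val_head_two:
  assumes "c 0 = 2"
  shows "1 \<le> code_val b c"
  using code_val_step [of c] code_val_bounds(1) [of "\<lambda>i. c (Suc i)"] assms b1 by simp

lemma code_val_head_small:
  assumes "c 0 \<le> 1"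
  shows "code_val b c \<le> 1 / b + 1 / (b - 1)"
proof -
  have "digit b (c 0) \<le> 1" using assms by (auto simp: digit_def)
  then have "code_val b c \<le> (1 + b / (b - 1)) / b"
    unfolding code_val_step [of c] using code_val_bounds(2) [of "\<lambda>i. c (Suc i)"] b1
    by (intro divide_right_mono) auto
  also have "\<dots> = 1 / b + 1 / (b - 1)" using b1 by (simp add: field_simps)
  finally show ?thesis .
qed

lemma code_val_const_one: "code_val b (\<lambda>_. 1) = 1 / (b - 1)"
  using code_val_step [of "\<lambda>_. 1"] b1 by (simp add: field_simps)

lemma code_val_const_two: "code_val b (\<lambda>_. 2) = b / (b - 1)"
  using code_val_step [of "\<lambda>_. 2"] b1 by (simp add: field_simps)

text \<open>The deviation from the constant code 1 is that of the tail starting with 2, divided by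
  \<open>b ^ m\<close>. For \<open>b > 2\<close> it is thus of exact order \<open>1 / b ^ m\<close>,
  which makes different bases comparable.\<close>

lemma code_val_ones_gap:
  assumes "\<And>j. j < m \<Longrightarrow> c j = 1" "c m = 2"
  shows "(1 - 1 / (b - 1)) / b ^ m \<le> code_val b c - 1 / (b - 1) \<and>
    code_val b c - 1 / (b - 1) \<le> 1 / b ^ m"
  using assms
proof (induction m arbitrary: c)
  case 0
  have "b / (b - 1) = 1 + 1 / (b - 1)" using b1 by (simp add: field_simps)
  then show ?case using code_val_head_two [of c] code_val_bounds(2) [of c] 0 by simp
next
  case (Suc m)
  let ?A = "code_val b (\<lambda>i. c (Suc i)) - 1 / (b - 1)"
  have "c 0 = 1" using Suc.prems by simp
  then have eq: "code_val b c - 1 / (b - 1) = ?A / b"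
    using code_val_step [of c] b1 by (simp add: field_simps)
  have IH: "(1 - 1 / (b - 1)) / b ^ m \<le> ?A" "?A \<le> 1 / b ^ m"
    using Suc.IH [of "\<lambda>i. c (Suc i)"] Suc.prems by auto
  have "(1 - 1 / (b - 1)) / b ^ m / b \<le> ?A / b" "?A / b \<le> 1 / b ^ m / b"
    using IH b1 by (intro divide_right_mono; simp)+
  then show ?case unfolding eq by (simp add: mult.commute)
qed

text \<open>The analogue at the right end point: a tail whose first letter is at most 1 stays at
  least \<open>1 - 1 / b\<close> away from it.\<close>

lemma code_val_twos_gap:
  assumes "\<And>j. j < m \<Longrightarrow> c j = 2" "c m \<le> 1"
  shows "(1 - 1 / b) / b ^ m \<le> b / (b - 1) - code_val b c \<and>
    b / (b - 1) - code_val b c \<le> b / (b - 1) / b ^ m"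
  using assms
proof (induction m arbitrary: c)
  case 0
  have "b / (b - 1) = 1 + 1 / (b - 1)" using b1 by (simp add: field_simps)
  then show ?case using code_val_head_small [of c] code_val_bounds(1) [of c] 0 by simp
next
  case (Suc m)
  let ?A = "b / (b - 1) - code_val b (\<lambda>i. c (Suc i))"
  have "c 0 = 2" using Suc.prems by simp
  then have eq: "b / (b - 1) - code_val b c = ?A / b"
    using code_val_step [of c] b1 by (simp add: field_simps)
  have IH: "(1 - 1 / b) / b ^ m \<le> ?A" "?A \<le> b / (b - 1) / b ^ m"
    using Suc.IH [of "\<lambda>i. c (Suc i)"] Suc.prems by auto
  have "(1 - 1 / b) / b ^ m / b \<le> ?A / b" "?A / b \<le> b / (b - 1) / b ^ m / b"
    using IH b1 by (intro divide_right_mono; simp)+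
  then show ?case unfolding eq by (simp add: mult.commute)
qed

end

section \<open>Hoelder comparison of the values of a code in two bases\<close>

lemma admissible_ones_then_two:
  assumes "admissible e" "e 0 = 1" "e \<noteq> (\<lambda>_. 1)"
  obtains m where "\<And>j. j < m \<Longrightarrow> e j = 1" "e m = 2"
proof -
  define m where "m = (LEAST m. e m \<noteq> 1)"
  have m: "e m \<noteq> 1" unfolding m_def by (rule LeastI_ex) (use assms(3) in auto)
  have less: "e j = 1" if "j < m" for j
    using not_less_Least that unfolding m_def by blast
  obtain k where k: "m = Suc k" using m assms(2) by (cases m) auto
  have "e k = 1" using less k by simp
  then have "e m \<noteq> 0" using assms(1) k by (auto simp: admissible_def)
  moreover have "e m \<le> 2" using assms(1) by (simp add: admissible_def)
  ultimately have "e m = 2" using m by linarith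
  then show thesis using less that by blast
qed

lemma twos_then_small:
  assumes "admissible c" "c \<noteq> (\<lambda>_. 2)"
  obtains m where "\<And>j. j < m \<Longrightarrow> c j = 2" "c m \<le> 1"
proof -
  define m where "m = (LEAST m. c m \<noteq> 2)"
  have m: "c m \<noteq> 2" unfolding m_def by (rule LeastI_ex) (use assms(2) in auto)
  have less: "c j = 2" if "j < m" for j
    using not_less_Least that unfolding m_def by blast
  have "c m \<le> 2" using assms(1) by (simp add: admissible_def)
  then have "c m \<le> 1" using m by linarith
  then show thesis using less that by blast
qed

context
  fixes q p s :: real
  assumes p: "2 < p" "p < q" and s: "0 < s" "q powr s = p"
    and sep: "1 / q + 1 / (q - 1) < 1"
begin

text \<open>Since \<open>q powr s = p\<close>, raising to the power \<open>s\<close> turns the scale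
  \<open>1 / q ^ m\<close> into \<open>1 / p ^ m\<close>.\<close>

lemma scale_powr:
  assumes "0 < a" "a / q ^ m \<le> x"
  shows "1 / p ^ m \<le> (1 / a) powr s * x powr s"
proof -
  have q: "0 < q" using p by simp
  have "1 / p ^ m = (1 / q ^ m) powr s"
  proof -
    have "(q ^ m) powr s = (q powr s) ^ m"
      using q by (simp add: powr_realpow [symmetric] powr_powr powr_power mult.commute)
    then show ?thesis using q s by (simp add: powr_divide)
  qed
  also have "\<dots> \<le> (1 / a * x) powr s"
    using assms q s by (intro powr_mono2) (auto simp: field_simps)
  also have "\<dots> = (1 / a) powr s * x powr s"
  proof -
    have "0 \<le> x" using assms q by (smt (verit) divide_pos_pos zero_less_power)
    then show ?thesis using powr_mult [of "1 / a" x s] assms(1) by simp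
  qed
  finally show ?thesis .
qed

text \<open>The codes \<open>0222...\<close> and \<open>1111...\<close> share the value
  \<open>1 / (b - 1)\<close> in every base \<open>b\<close>, so codes with heads 0 and 1 may come
  arbitrarily close. This value separates them: \<open>e\<close> lies above it by \<open>?A\<close>
  and \<open>c\<close> below it by \<open>?B\<close>. Both parts have known order, as
  \<open>e\<close> can leave \<open>1111...\<close> only by a 2, and each is at most the full
  difference \<open>D\<close> in base \<open>q\<close>.\<close>

lemma code_val_Hoelder_01:
  assumes ad: "admissible c" "admissible e" and 01: "c 0 = 0" "e 0 = 1"
  shows "\<bar>code_val p c - code_val p e\<bar> \<le>
    ((1 / (1 - 1 / (q - 1))) powr s + p / (p - 1) * (1 / (1 - 1 / q)) powr s) *
      \<bar>code_val q c - code_val q e\<bar> powr s"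
proof -
  have q1: "1 < q" and p1: "1 < p" using p by auto
  let ?A = "\<lambda>b. code_val b e - 1 / (b - 1)"
  let ?B = "\<lambda>b. 1 / (b - 1) - code_val b c"
  have pos: "0 < 1 - 1 / (b - 1)" if "2 < b" for b :: real using that by simp
  have A: "0 \<le> ?A q \<and> 0 \<le> ?A p \<and> ?A p \<le> (1 / (1 - 1 / (q - 1))) powr s * (?A q) powr s"
  proof (cases "e = (\<lambda>_. 1)")
    case True
    then show ?thesis using code_val_const_one [OF q1] code_val_const_one [OF p1] by simp
  next
    case False
    then obtain m where m: "\<And>j. j < m \<Longrightarrow> e j = 1" "e m = 2"
      using admissible_ones_then_two [OF ad(2) 01(2)] by blast
    have gq: "(1 - 1 / (q - 1)) / q ^ m \<le> ?A q" using code_val_ones_gap [OF q1, of m e] m by simp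
    have gp: "(1 - 1 / (p - 1)) / p ^ m \<le> ?A p" "?A p \<le> 1 / p ^ m"
      using code_val_ones_gap [OF p1, of m e] m by auto
    have "0 \<le> (1 - 1 / (b - 1)) / b ^ m" if "2 < b" for b :: real
      using that pos [OF that] by (intro divide_nonneg_nonneg) auto
    from this [of q] this [of p] have "0 \<le> ?A q" "0 \<le> ?A p" using gq gp p by linarith+
    then show ?thesis using gp(2) scale_powr [OF pos gq] p by linarith
  qed
  let ?c = "\<lambda>i. c (Suc i)"
  have Beq: "?B b = (b / (b - 1) - code_val b ?c) / b" if "1 < b" for b
    using code_val_step [OF that, of c] 01 that by (simp add: field_simps)
  have posB: "0 < 1 - 1 / q" using q1 by simp
  have B: "0 \<le> ?B q \<and> 0 \<le> ?B p \<and> ?B p \<le> p / (p - 1) * ((1 / (1 - 1 / q)) powr s * (?B q) powr s)"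
  proof (cases "?c = (\<lambda>_. 2)")
    case True
    then have "?B q = 0" "?B p = 0"
      using Beq [OF q1] Beq [OF p1] code_val_const_two [OF q1] code_val_const_two [OF p1] by simp_all
    then show ?thesis by simp
  next
    case False
    then obtain m where m: "\<And>j. j < m \<Longrightarrow> ?c j = 2" "?c m \<le> 1"
      using twos_then_small [OF admissible_Suc [OF ad(1)]] by blast
    have "(1 - 1 / q) / q ^ m / q \<le> ?B q"
      unfolding Beq [OF q1] using code_val_twos_gap [OF q1, of m ?c] m q1 by (intro divide_right_mono) auto
    then have "1 / p ^ Suc m \<le> (1 / (1 - 1 / q)) powr s * (?B q) powr s"
      using posB by (intro scale_powr) (simp_all add: mult.commute)
    then have "p / (p - 1) * (1 / p ^ Suc m) \<le> p / (p - 1) * ((1 / (1 - 1 / q)) powr s * (?B q) powr s)"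
      using p1 by (intro mult_left_mono) auto
    moreover have "?B p \<le> p / (p - 1) / p ^ m / p"
      unfolding Beq [OF p1] using code_val_twos_gap [OF p1, of m ?c] m p1 by (intro divide_right_mono) auto
    moreover have "p / (p - 1) / p ^ m / p = p / (p - 1) * (1 / p ^ Suc m)" by (simp add: mult.commute)
    moreover have "0 \<le> ?B q" "0 \<le> ?B p"
      using Beq [OF q1] Beq [OF p1] code_val_bounds(2) [OF q1, of ?c] code_val_bounds(2) [OF p1, of ?c] p1 q1
      by simp_all
    ultimately show ?thesis by linarith
  qed
  define D where "D = ?A q + ?B q"
  have D: "D = \<bar>code_val q c - code_val q e\<bar>" using A B by (simp add: D_def)
  have "(?A q) powr s \<le> D powr s" "(?B q) powr s \<le> D powr s"
    using A B s by (auto simp: D_def intro!: powr_mono2)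
  then have "(1 / (1 - 1 / (q - 1))) powr s * (?A q) powr s \<le> (1 / (1 - 1 / (q - 1))) powr s * D powr s"
    "p / (p - 1) * ((1 / (1 - 1 / q)) powr s * (?B q) powr s) \<le> p / (p - 1) * ((1 / (1 - 1 / q)) powr s * D powr s)"
    using p1 by (intro mult_left_mono; simp)+
  then have "?A p + ?B p \<le> (1 / (1 - 1 / (q - 1))) powr s * D powr s +
      p / (p - 1) * ((1 / (1 - 1 / q)) powr s * D powr s)"
    using A B by linarith
  moreover have "\<bar>code_val p c - code_val p e\<bar> = ?A p + ?B p" using A B by simp
  ultimately show ?thesis unfolding D by (simp add: distrib_right mult.assoc)
qed

text \<open>By \<open>sep\<close> the pieces for the digits 1 and \<open>q\<close> are a positive
  distance \<open>g\<close> apart in base \<open>q\<close>, so the trivial bound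
  \<open>p / (p - 1)\<close> for distances in base \<open>p\<close> suffices.\<close>

lemma code_val_Hoelder_2:
  assumes "c 0 \<le> 1" "e 0 = 2"
  shows "\<bar>code_val p c - code_val p e\<bar> \<le>
    p / (p - 1) * (1 / (1 - 1 / q - 1 / (q - 1))) powr s * \<bar>code_val q c - code_val q e\<bar> powr s"
proof -
  have q1: "1 < q" and p1: "1 < p" using p by auto
  define g where "g = 1 - 1 / q - 1 / (q - 1)"
  have "0 < g" using sep by (simp add: g_def)
  have "g \<le> \<bar>code_val q c - code_val q e\<bar>"
    using code_val_head_two [OF q1, of e] code_val_head_small [OF q1, of c] assms by (simp add: g_def)
  then have "1 / p ^ 0 \<le> (1 / g) powr s * \<bar>code_val q c - code_val q e\<bar> powr s"
    using \<open>0 < g\<close> by (intro scale_powr) auto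
  then have "p / (p - 1) * 1 \<le> p / (p - 1) * ((1 / g) powr s * \<bar>code_val q c - code_val q e\<bar> powr s)"
    using p1 by (intro mult_left_mono) auto
  moreover have "\<bar>code_val p c - code_val p e\<bar> \<le> p / (p - 1)"
    using code_val_bounds [OF p1, of c] code_val_bounds [OF p1, of e] by linarith
  ultimately show ?thesis unfolding g_def by (simp add: mult.assoc)
qed

text \<open>A common first letter divides the distance in base \<open>p\<close> by \<open>p\<close>,
  and the \<open>s\<close>-th power of the distance in base \<open>q\<close> by
  \<open>q powr s = p\<close>. Stripping common letters thus preserves the estimate, down to codes
  with different heads.\<close>

lemma code_val_Hoelder:
  "\<exists>C\<ge>0. \<forall>c e. admissible c \<longrightarrow> admissible e \<longrightarrow>
     \<bar>code_val p c - code_val p e\<bar> \<le> C * \<bar>code_val q c - code_val q e\<bar> powr s"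
proof -
  have q1: "1 < q" and p1: "1 < p" using p by auto
  define C1 where "C1 = (1 / (1 - 1 / (q - 1))) powr s + p / (p - 1) * (1 / (1 - 1 / q)) powr s"
  define C2 where "C2 = p / (p - 1) * (1 / (1 - 1 / q - 1 / (q - 1))) powr s"
  define C where "C = max C1 C2"
  have "0 \<le> C2" using p1 by (simp add: C2_def)
  have base: "\<bar>code_val p c - code_val p e\<bar> \<le> C * \<bar>code_val q c - code_val q e\<bar> powr s"
    if "admissible c" "admissible e" "c 0 < e 0" for c e
  proof -
    have "e 0 \<le> 2" using that(2) by (simp add: admissible_def)
    then consider "e 0 = 2" "c 0 \<le> 1" | "c 0 = 0" "e 0 = 1" using \<open>c 0 < e 0\<close> by linarith
    then have "\<bar>code_val p c - code_val p e\<bar> \<le> C1 * \<bar>code_val q c - code_val q e\<bar> powr s \<or>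
        \<bar>code_val p c - code_val p e\<bar> \<le> C2 * \<bar>code_val q c - code_val q e\<bar> powr s"
      using code_val_Hoelder_2 code_val_Hoelder_01 [OF that(1,2)] unfolding C1_def C2_def by metis
    moreover have "C1 * x powr s \<le> C * x powr s" "C2 * x powr s \<le> C * x powr s" for x
      by (auto simp: C_def intro: mult_right_mono)
    ultimately show ?thesis by (meson order_trans)
  qed
  have "\<bar>code_val p c - code_val p e\<bar> \<le> C * \<bar>code_val q c - code_val q e\<bar> powr s"
    if "admissible c" "admissible e" "c k \<noteq> e k" for c e k
    using that
  proof (induction k arbitrary: c e rule: less_induct)
    case (less k)
    show ?case
    proof (cases "c 0 = e 0")
      case False
      then consider "c 0 < e 0" | "e 0 < c 0" by linarith
      then show ?thesis
      proof cases
        case 2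
        then show ?thesis using base [OF less.prems(2,1)] by (simp add: abs_minus_commute)
      qed (use base less.prems in blast)
    next
      case True
      let ?c = "\<lambda>i. c (Suc i)" and ?e = "\<lambda>i. e (Suc i)"
      obtain j where "k = Suc j" using less.prems(3) True by (cases k) auto
      then have IH: "\<bar>code_val p ?c - code_val p ?e\<bar> \<le> C * \<bar>code_val q ?c - code_val q ?e\<bar> powr s"
        using less.IH [of j ?c ?e] less.prems admissible_Suc by auto
      have eq: "\<bar>code_val b c - code_val b e\<bar> = \<bar>code_val b ?c - code_val b ?e\<bar> / b" if "1 < b" for b
        using code_val_step [OF that, of c] code_val_step [OF that, of e] True that
        by (simp add: diff_divide_distrib [symmetric])
      have "\<bar>code_val q c - code_val q e\<bar> powr s = \<bar>code_val q ?c - code_val q ?e\<bar> powr s / p"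
        unfolding eq [OF q1] using s q1 by (simp add: powr_divide)
      moreover have "\<bar>code_val p c - code_val p e\<bar> \<le> C * \<bar>code_val q ?c - code_val q ?e\<bar> powr s / p"
        unfolding eq [OF p1] using IH p1 by (intro divide_right_mono) auto
      ultimately show ?thesis by simp
    qed
  qed
  moreover have "\<bar>code_val p c - code_val p c\<bar> \<le> C * \<bar>code_val q c - code_val q c\<bar> powr s" for c
    using s by simp
  moreover have "0 \<le> C" using \<open>0 \<le> C2\<close> by (simp add: C_def)
  ultimately show ?thesis by (metis ext)
qed

end

text \<open>By \<open>M\<close>, \<open>p = 2 + \<kappa>\<close> with \<kappa> the fixed point of
  \<open>\<lambda>z. p * z - 1\<close>. Choose 0 below \<kappa>, 1 from \<kappa> up to 1, and
  \<open>p\<close> from 1 on; the relation \<open>p = 2 + \<kappa>\<close> keeps the remainder after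
  a 1 in the interval. That remainder is at least \<kappa>, so 0 never follows 1.\<close>

lemma admissible_code_exists:
  assumes p: "1 < p" "p \<le> q_star" "2 < p" and y: "y \<in> {0..p / (p - 1)}" and M: "p - 1 = p / (p - 1)"
  shows "\<exists>c. admissible c \<and> code_val p c = y"
proof -
  define \<kappa> where "\<kappa> = 1 / (p - 1)"
  have \<kappa>: "p * \<kappa> = 1 + \<kappa>" "p / (p - 1) = 1 + \<kappa>" "0 < \<kappa>" "\<kappa> < 1" "p = 2 + \<kappa>"
    using p M by (auto simp: \<kappa>_def field_simps)
  let ?P = "\<lambda>y a. (a = 0 \<longrightarrow> y < \<kappa>) \<and> (a = 1 \<longrightarrow> \<kappa> \<le> y)"
  let ?S = "{0..p / (p - 1)}"
  have "\<exists>d \<in> q_expansions p y. \<exists>r. r 0 = y \<and> (\<forall>n. r n \<in> ?S \<and> ?P (r n) (d n) \<and> r (Suc n) = p * r n - d n)"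
  proof (rule E_if_closed [OF p(1) _ order_refl y])
    fix z assume z: "z \<in> ?S"
    consider "z < \<kappa>" | "\<kappa> \<le> z" "z < 1" | "1 \<le> z" by linarith
    then show "\<exists>a\<in>{0, 1, p}. ?P z a \<and> p * z - a \<in> ?S"
    proof cases
      case 1
      have "p * z \<le> p * \<kappa>" using 1 p by (intro mult_left_mono) auto
      then show ?thesis using 1 z \<kappa>(1-4) p by (intro bexI [of _ 0]) auto
    next
      case 2
      have "p * \<kappa> \<le> p * z" "p * z \<le> p * 1" using 2 p by (auto intro!: mult_left_mono)
      then have "0 \<le> p * z - 1" "p * z - 1 \<le> 1 + \<kappa>" using \<kappa> by linarith+
      then show ?thesis using 2 z \<kappa>(2) p by (intro bexI [of _ 1]) auto
    next
      case 3
      have "p * 1 \<le> p * z" "p * z \<le> p * (1 + \<kappa>)" using 3 z \<kappa>(2) p by (auto intro!: mult_left_mono)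
      then have "0 \<le> p * z - p" "p * z - p \<le> 1 + \<kappa>" using \<kappa>(1) by (auto simp: distrib_left)
      then show ?thesis using 3 z \<kappa>(2) p by (intro bexI [of _ p]) auto
    qed
  qed
  then obtain d r where d: "d \<in> q_expansions p y" and r: "\<And>n. ?P (r n) (d n)" "\<And>n. r (Suc n) = p * r n - d n"
    by blast
  define c where "c i = (if d i = 0 then 0 else if d i = 1 then 1 else 2 :: nat)" for i
  have dig: "d i \<in> {0, 1, p}" for i using d by (simp add: q_expansions_def)
  have "digit p (c i) = d i" for i using dig [of i] p by (auto simp: c_def)
  then have "code_val p c = y" using d by (intro code_val_eqI [OF p(1)]) simp
  moreover have "\<not> (d i = 1 \<and> d (Suc i) = 0)" for i
  proof
    assume i: "d i = 1 \<and> d (Suc i) = 0"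
    then have "\<kappa> \<le> r i" "r (Suc i) = p * r i - 1" "r (Suc i) < \<kappa>" using r(1) [of i] r(1) [of "Suc i"] r(2) [of i] by auto
    moreover have "p * \<kappa> \<le> p * r i" using \<open>\<kappa> \<le> r i\<close> p by (intro mult_left_mono) auto
    ultimately show False using \<kappa>(1) by linarith
  qed
  then have "admissible c" by (auto simp: admissible_def c_def)
  ultimately show ?thesis by blast
qed

lemma E_not_null_large_base:
  assumes "q_star < q"
  shows "hausdorff_measure (log q q_star) (E_set q) \<noteq> 0"
proof -
  let ?p = q_star and ?s = "log q q_star"
  have p: "2 < ?p" by (rule q_star_gt_2)
  have pp: "?p - 1 = ?p / (?p - 1)"
    using p q_star_root by (simp add: field_simps power2_eq_square)
  have q1: "1 < q" using p assms by simp
  have s: "0 < ?s" "q powr ?s = ?p" using p q1 by auto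
  have "0 < q\<^sup>2 - 3 * q + 1" using q_star_quadratic [OF q1] assms by linarith
  then have sep: "1 / q + 1 / (q - 1) < 1" using q1 by (simp add: field_simps power2_eq_square)
  obtain C where C: "0 \<le> C" "\<And>c e. admissible c \<Longrightarrow> admissible e \<Longrightarrow>
      \<bar>code_val ?p c - code_val ?p e\<bar> \<le> C * \<bar>code_val q c - code_val q e\<bar> powr ?s"
    using code_val_Hoelder [OF p assms s sep] by blast
  show ?thesis
  proof (rule hausdorff_not_null_if_Hoelder [OF s(1) C(1), where m = "?p / (?p - 1)"
        and R = "{(code_val q c, code_val ?p c) | c. admissible c}"])
    show "0 < ?p / (?p - 1)" using p by simp
    show "Domain {(code_val q c, code_val ?p c) | c. admissible c} \<subseteq> E_set q"
      using code_expansion [OF q1] by (auto simp: E_set_def)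
    show "{0..?p / (?p - 1)} \<subseteq> Range {(code_val q c, code_val ?p c) | c. admissible c}"
    proof
      fix y assume "y \<in> {0..?p / (?p - 1)}"
      then obtain c where "admissible c" "code_val ?p c = y"
        using admissible_code_exists [of ?p y] p pp by auto
      then show "y \<in> Range {(code_val q c, code_val ?p c) | c. admissible c}" by blast
    qed
  qed (use C(2) in \<open>auto simp: dist_real_def\<close>)
qed

text \<open>The removed set \<open>?N\<close> is null for all exponents above a threshold lying
  below an exponent at which \<open>E_set q\<close> is not null: 0 against 1 when \<open>?N\<close>
  is countable, \<open>log q q_c\<close> against 1 up to \<open>q_star\<close>, and
  \<open>log q q_c\<close> against \<open>log q q_star\<close> beyond.\<close>

lemma hausdorff_dim_U_continuum:
  assumes q1: "1 < q"
  shows "hausdorff_dim (U_set q (UNIV :: nat set set)) = hausdorff_dim (E_set q)"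
proof -
  let ?N = "{x \<in> E_set q. \<not> (UNIV :: nat set set) \<lesssim> q_expansions q x}"
  have E: "E_set q = U_set q (UNIV :: nat set set) \<union> ?N"
    using lepoll_antisym expansions_lepoll_continuum [OF q1] by (auto simp: U_set_def)
  have qc: "1 < q_c" "q_c < q_star"
    using q_c_bounds q_c_less_q_star by simp_all
  consider "q \<le> q_c" | "q_c < q" "q \<le> q_star" | "q_star < q" by linarith
  then show ?thesis
  proof cases
    case 1
    then have "countable ?N"
      by (intro countable_U_if_unique_trivial [OF q1] unique_trivial_small_base [OF q1])
    then show ?thesis
      using 1 qc E_not_null_if_interval [OF q1] hausdorff_null_countable [of _ ?N]
      by (intro hausdorff_dim_remove_small [OF E, of 0 1]) auto
  next
    case 2
    then show ?thesis
      using qc q1 non_continuum_null [OF q1] E_not_null_if_interval [OF q1]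
      by (intro hausdorff_dim_remove_small [OF E, of "log q q_c" 1]) auto
  next
    case 3
    then show ?thesis
      using qc q1 non_continuum_null [OF q1] E_not_null_large_base
      by (intro hausdorff_dim_remove_small [OF E, of "log q q_c" "log q q_star"]) auto
  qed
qed

theorem theorem3:
  shows "(\<forall>q \<in> B_aleph0 - {q_c<..<q_star}.
            countable (U_set q (UNIV :: nat set)) \<and> infinite (U_set q (UNIV :: nat set))) \<and>
         (\<forall>q > 1. hausdorff_dim (U_set q (UNIV :: nat set set)) = hausdorff_dim (E_set q))"
proof (intro conjI ballI allI impI)
  fix q assume "q \<in> B_aleph0 - {q_c<..<q_star}"
  from U_nat_countable_infinite [OF this]
  show "countable (U_set q (UNIV :: nat set))" "infinite (U_set q (UNIV :: nat set))"
    by blast+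
qed (rule hausdorff_dim_U_continuum)

end
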